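(* Let $G$ be a compact group. Then every dense subgroup of $G$ is projectively Arhangel'skiĭ if and only if $G$ is metrizable.
   Context: All spaces and topological groups are assumed to be Hausdorff. Compact groups are not assumed to be abelian. $w(X)$ denotes the weight of a space $X$. A space $X$ has the Arhangel'skiĭ property if $w(X)\le |X|$. A topological group $G$ is projectively Arhangel'skiĭ if every (Hausdorff) topological group that is the image of $G$ under a continuous surjective homomorphism has the Arhangel'skiĭ property. Subgroups carry the subspace topology. *)

theory Defs
  imports "HOL-Analysis.Analysis" "HOL-Algebra.Coset"
begin

unbundle cardinal_syntax

definition topology_base :: "'a topology \<Rightarrow> 'a set set \<Rightarrow> bool"
  where "topology_base X B \<longleftrightarrow> openin X = arbitrary union_of (\<lambda>U. U \<in> B)"

text \<open>The weight is the exact minimum of the cardinalities of bases, represented (as usual for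
  cardinals in HOL) by a cardinal well-order. It is not rounded up to the first infinite cardinal,
  so that a finite discrete space has weight equal to its number of points.\<close>

definition weight :: "'a topology \<Rightarrow> 'a set rel"
  where "weight X = |SOME B. topology_base X B \<and> (\<forall>B'. topology_base X B' \<longrightarrow> |B| \<le>o |B'| )|"

definition arhangelskii :: "'a topology \<Rightarrow> bool"
  where "arhangelskii X \<longleftrightarrow> weight X \<le>o |topspace X|"

text \<open>Topological groups are Hausdorff by convention.\<close>

locale topological_group = group G
  for G :: "('a, 'm) monoid_scheme" (structure) and T :: "'a topology" +
  assumes topspace_eq: "topspace T = carrier G"
    and continuous_mult: "continuous_map (prod_topology T T) T (\<lambda>(x, y). x \<otimes> y)"
    and continuous_inv: "continuous_map T T (\<lambda>x. inv x)"
    and Hausdorff: "Hausdorff_space T"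

text \<open>A formula cannot quantify over types, so the images of \<open>G\<close> range over the topological groups
  whose carrier is a set of subsets of the type of \<open>G\<close>. This loses nothing: an image is in bijection
  with the set of fibres of the homomorphism. The lemma \<open>projectively_arhangelskii_image\<close> below
  recovers the statement for images of arbitrary type.\<close>

definition projectively_arhangelskii :: "('a, 'm) monoid_scheme \<Rightarrow> 'a topology \<Rightarrow> bool"
  where "projectively_arhangelskii G T \<longleftrightarrow>
    (\<forall>(K :: 'a set monoid) S f.
       topological_group K S \<and> f \<in> epi G K \<and> continuous_map T S f \<longrightarrow> arhangelskii S)"

lemma weight_least:
  "\<exists>B. topology_base X B \<and> weight X = |B| \<and> (\<forall>B'. topology_base X B' \<longrightarrow> |B| \<le>o |B'| )"
proof -
  let ?R = "{r. \<exists>B. topology_base X B \<and> r = |B|}"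
  have "topology_base X {U. openin X U}"
    unfolding topology_base_def
    by (rule openin_topology_base_unique[THEN iffD2]) auto
  then have ne: "?R \<noteq> {}" by blast
  have "\<forall>r\<in>?R. Card_order r" using card_of_Card_order by blast
  from exists_minim_Card_order[OF ne this]
  obtain B where B: "topology_base X B" "\<forall>B'. topology_base X B' \<longrightarrow> |B| \<le>o |B'|"
    by blast
  let ?P = "\<lambda>B. topology_base X B \<and> (\<forall>B'. topology_base X B' \<longrightarrow> |B| \<le>o |B'| )"
  have "?P (SOME B. ?P B)"
    by (rule someI[of ?P B]) (use B in blast)
  then show ?thesis
    unfolding weight_def by blast
qed

lemma topology_base_homeomorphic:
  assumes "homeomorphic_map X Y g" "topology_base X B"
  shows "topology_base Y ((`) g ` B)"
  unfolding topology_base_def openin_topology_base_unique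
proof (intro conjI allI impI)
  have B: "\<And>V. V \<in> B \<Longrightarrow> openin X V"
    "\<And>U x. openin X U \<Longrightarrow> x \<in> U \<Longrightarrow> \<exists>V. V \<in> B \<and> x \<in> V \<and> V \<subseteq> U"
    using assms(2) unfolding topology_base_def openin_topology_base_unique by blast+
  have op: "open_map X Y g" and co: "continuous_map X Y g" and im: "g ` topspace X = topspace Y"
    using assms(1) by (auto simp: homeomorphic_map_def homeomorphic_imp_open_map
        homeomorphic_imp_continuous_map homeomorphic_imp_surjective_map)
  show "openin Y V" if "V \<in> (`) g ` B" for V
    using that op B(1) unfolding open_map_def by auto
  show "\<exists>V. V \<in> (`) g ` B \<and> y \<in> V \<and> V \<subseteq> U" if U: "openin Y U \<and> y \<in> U" for U y
  proof -
    from U have "y \<in> g ` topspace X"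
      using im openin_subset[of Y U] by auto
    then obtain x where x: "x \<in> topspace X" "g x = y" by auto
    have "openin X {x \<in> topspace X. g x \<in> U}"
      using co U by (simp add: openin_continuous_map_preimage)
    from B(2)[OF this, of x] x U
    obtain V where "V \<in> B" "x \<in> V" "V \<subseteq> {x \<in> topspace X. g x \<in> U}"
      by auto
    then show ?thesis using x by (intro exI[of _ "g ` V"]) auto
  qed
qed

lemma arhangelskii_homeomorphic:
  assumes g: "homeomorphic_map X Y g" and "arhangelskii X"
  shows "arhangelskii Y"
proof -
  obtain B where B: "topology_base X B" "weight X = |B|"
    using weight_least[of X] by (elim exE conjE)
  obtain C where C: "weight Y = |C|" "\<forall>C'. topology_base Y C' \<longrightarrow> |C| \<le>o |C'|"
    using weight_least[of Y] by (elim exE conjE)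
  have "|C| \<le>o |(`) g ` B|"
    using C(2) topology_base_homeomorphic[OF g B(1)] by blast
  also have "|(`) g ` B| \<le>o |B|" by (rule card_of_image)
  also have "|B| \<le>o |topspace X|" using assms(2) B(2) by (simp add: arhangelskii_def)
  also have "|topspace X| \<le>o |topspace Y|"
    using homeomorphic_imp_injective_map[OF g] homeomorphic_imp_surjective_map[OF g]
    by (metis card_of_ordLeq order_refl)
  finally show ?thesis using C(1) by (simp add: arhangelskii_def)
qed

lemma projectively_arhangelskii_image:
  fixes G :: "('a, 'm) monoid_scheme" and K :: "('b, 'n) monoid_scheme"
  assumes G: "projectively_arhangelskii G T" and K: "topological_group K S"
    and f: "f \<in> epi G K" and cont: "continuous_map T S f"
  shows "arhangelskii S"
proof -
  interpret K: topological_group K S by (rule K)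
  define g where "g y = {x \<in> carrier G. f x = y}" for y
  define k where "k = inv_into (carrier K) g"
  define K' where "K' = \<lparr>carrier = g ` carrier K,
    monoid.mult = (\<lambda>a b. g (k a \<otimes>\<^bsub>K\<^esub> k b)), one = g \<one>\<^bsub>K\<^esub>\<rparr>"
  define S' where "S' = pullback_topology (g ` carrier K) k S"
  have fh: "f \<in> hom G K" and fim: "f ` carrier G = carrier K"
    using f by (auto simp: epi_def)
  have inj: "inj_on g (carrier K)"
  proof (rule inj_onI)
    fix y z assume yz: "y \<in> carrier K" "z \<in> carrier K" "g y = g z"
    then have "y \<in> f ` carrier G" by (simp add: fim)
    then obtain x where "x \<in> carrier G" "f x = y" by auto
    then have "x \<in> g z" using yz(3) by (auto simp: g_def)
    then show "y = z" using \<open>f x = y\<close> by (simp add: g_def)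
  qed
  have kg [simp]: "k (g y) = y" if "y \<in> carrier K" for y
    using that inj by (simp add: k_def)
  have top: "topspace S' = g ` carrier K"
    unfolding S'_def topspace_pullback_topology using K.topspace_eq by auto
  have ck: "continuous_map S' S k"
    unfolding S'_def using continuous_map_pullback[OF continuous_map_id, where f = k] by (simp add: o_def)
  have cg: "continuous_map S S' g"
    unfolding S'_def
  proof (rule continuous_map_pullback')
    show "continuous_map S S (k \<circ> g)"
      by (rule continuous_map_eq[OF continuous_map_id]) (simp add: K.topspace_eq)
  qed (auto simp: K.topspace_eq)
  have hm: "homeomorphic_maps S S' g k"
    unfolding homeomorphic_maps_def using cg ck by (auto simp: top K.topspace_eq)
  have grp: "group K'"
  proof (rule groupI)
    fix x assume "x \<in> carrier K'"
    then obtain y where y: "y \<in> carrier K" "x = g y" by (auto simp: K'_def)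
    show "\<exists>y\<in>carrier K'. y \<otimes>\<^bsub>K'\<^esub> x = \<one>\<^bsub>K'\<^esub>"
      by (rule bexI[of _ "g (inv\<^bsub>K\<^esub> y)"]) (use y in \<open>auto simp: K'_def\<close>)
  qed (auto simp: K'_def K.m_assoc)
  have inv': "inv\<^bsub>K'\<^esub> (g y) = g (inv\<^bsub>K\<^esub> y)" if "y \<in> carrier K" for y
    by (rule group.inv_equality[OF grp]) (use that in \<open>auto simp: K'_def\<close>)
  have "topological_group K' S'"
  proof (intro topological_group.intro topological_group_axioms.intro grp)
    show "topspace S' = carrier K'" by (simp add: top K'_def)
    have "continuous_map (prod_topology S' S') (prod_topology S S) (\<lambda>(a, b). (k a, k b))"
      by (simp add: continuous_map_prod_top ck)
    from continuous_map_compose[OF continuous_map_compose[OF this K.continuous_mult] cg]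
    show "continuous_map (prod_topology S' S') S' (\<lambda>(x, y). x \<otimes>\<^bsub>K'\<^esub> y)"
      by (simp add: K'_def o_def split_def)
    have "continuous_map S' S' (g \<circ> ((\<lambda>x. inv\<^bsub>K\<^esub> x) \<circ> k))"
      by (intro continuous_map_compose[OF _ cg] continuous_map_compose[OF ck] K.continuous_inv)
    then show "continuous_map S' S' (\<lambda>x. inv\<^bsub>K'\<^esub> x)"
      by (rule continuous_map_eq) (auto simp: top inv')
    show "Hausdorff_space S'"
      using K.Hausdorff hm homeomorphic_Hausdorff_space homeomorphic_space_def by blast
  qed
  moreover have "g \<circ> f \<in> hom G K'"
    using fh by (auto simp: hom_def K'_def Pi_iff)
  then have "g \<circ> f \<in> epi G K'"
    by (simp add: epi_def K'_def image_image flip: fim)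
  moreover have "continuous_map T S' (g \<circ> f)"
    by (rule continuous_map_compose[OF cont cg])
  ultimately have "arhangelskii S'"
    using G unfolding projectively_arhangelskii_def by blast
  moreover have "homeomorphic_map S' S k"
    using hm homeomorphic_maps_map homeomorphic_maps_sym by blast
  ultimately show ?thesis by (rule arhangelskii_homeomorphic[rotated])
qed

end

theory Submission
  imports Defs "HOL-Library.Countable_Set_Type" "HOL-Algebra.Generated_Groups"
begin

text \<open>If \<open>G\<close> is metrizable, then it is second countable, and by compactness so is every continuous
  image of a dense subgroup; an infinite image is therefore Arhangel'skii, and a finite one is discrete.

  For the converse it suffices to find a closed normal subgroup \<open>N\<close> such that \<open>G/N\<close> is separable,
  and metrizable only if \<open>N\<close> is trivial: the subgroup of \<open>G/N\<close> generated by a countable dense set is an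
  image of a dense subgroup of \<open>G\<close>, so by hypothesis it is second countable, which makes \<open>G/N\<close>
  metrizable. Such an \<open>N\<close> is the first entry of a minimal pair of a closed normal subgroup \<open>N\<close> and a
  sequence in \<open>G/N\<close> meeting every nonempty open set infinitely often. Zorn's lemma applies because, by
  compactness, an open set in the quotient by the intersection of a chain contains one that comes from
  a member of the chain. Minimality yields what is wanted: if \<open>G/N\<close> is metrizable and \<open>N\<close> is
  nontrivial, there is a closed normal \<open>N' \<subset> N\<close> with \<open>G/N'\<close> still metrizable, and the sequence
  lifts to \<open>G/N'\<close> with the same property, since the \<open>k\<close>-th member of a countable base can be met by
  the lift of a term whose index has not been used before. This replaces the theorem that compact groups
  of weight at most the continuum are separable.\<close>

subsection \<open>Countable bases of topological groups\<close>

lemma (in group) mult_inv_cancel: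
  assumes "x \<in> carrier G" "y \<in> carrier G"
  shows "x \<otimes> (inv x \<otimes> y) = y" "inv x \<otimes> (x \<otimes> y) = y"
  using assms by (simp_all flip: m_assoc)

lemma (in topological_group) continuous_map_mult:
  assumes "continuous_map X T f" "continuous_map X T g"
  shows "continuous_map X T (\<lambda>x. f x \<otimes> g x)"
proof -
  have "continuous_map X (prod_topology T T) (\<lambda>x. (f x, g x))"
    using assms by (simp add: continuous_map_pairedI)
  from continuous_map_compose[OF this continuous_mult] show ?thesis
    by (simp add: o_def)
qed

lemma (in topological_group) continuous_map_inverse:
  assumes "continuous_map X T f"
  shows "continuous_map X T (\<lambda>x. inv (f x))"
  using continuous_map_compose[OF assms continuous_inv] by (simp add: o_def)

lemma (in topological_group) continuous_map_constant:
  assumes "a \<in> carrier G"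
  shows "continuous_map X T (\<lambda>x. a)"
  using assms by (simp add: topspace_eq)

text \<open>Used as introduction rules, these prove continuity of every word in the group
  operations, with constants and coordinates as letters.\<close>

lemmas (in topological_group) continuous_map_group =
  continuous_map_mult continuous_map_inverse continuous_map_constant
  continuous_map_fst continuous_map_snd continuous_map_id[unfolded id_def]

lemma (in topological_group) openin_carrier:
  "openin T U \<Longrightarrow> U \<subseteq> carrier G"
  using openin_subset topspace_eq by blast

lemma (in topological_group) openin_vimage:
  assumes "continuous_map T T f" "openin T U"
  shows "openin T {x \<in> carrier G. f x \<in> U}"
  using openin_continuous_map_preimage[OF assms] by (simp add: topspace_eq)

text \<open>Joint continuity at a point, phrased with rectangles. The curried \<open>f\<close> lets
  words such as \<open>inv u \<otimes> v\<close> be substituted directly.\<close>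

lemma (in topological_group) continuous_map_nbhd2:
  assumes f: "continuous_map (prod_topology T T) T (\<lambda>z. f (fst z) (snd z))"
    and "openin T U" "f a b \<in> U" "a \<in> carrier G" "b \<in> carrier G"
  obtains A B where "openin T A" "a \<in> A" "openin T B" "b \<in> B"
    "\<And>x y. x \<in> A \<Longrightarrow> y \<in> B \<Longrightarrow> f x y \<in> U"
proof -
  define W where "W = {z \<in> topspace (prod_topology T T). f (fst z) (snd z) \<in> U}"
  have "openin (prod_topology T T) W"
    unfolding W_def by (rule openin_continuous_map_preimage[OF f assms(2)])
  moreover have "(a, b) \<in> W"
    using assms by (simp add: W_def topspace_eq)
  ultimately have "\<exists>A B. openin T A \<and> openin T B \<and> a \<in> A \<and> b \<in> B \<and> A \<times> B \<subseteq> W"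
    by (rule openin_prod_topology_alt[THEN iffD1, rule_format])
  then obtain A B where AB: "openin T A" "openin T B" "a \<in> A" "b \<in> B" "A \<times> B \<subseteq> W"
    by (elim exE conjE)
  show thesis
    by (rule that[OF AB(1,3,2,4)]) (use AB(5) in \<open>auto simp: W_def\<close>)
qed

text \<open>If \<open>H\<close> is dense, the translates of \<open>U\<close> by elements of
  \<open>H\<close> cover the group, and compactness leaves finitely many of them. Taking them from
  \<open>H\<close> matters for homomorphisms that are defined only on \<open>H\<close>.\<close>

lemma (in topological_group) finite_translates_cover:
  assumes "compact_space T" and H: "H \<subseteq> carrier G" "T closure_of H = topspace T"
    and U: "openin T U" "\<one> \<in> U"
  shows "\<exists>F. finite F \<and> F \<subseteq> H \<and> (\<forall>x\<in>carrier G. \<exists>h\<in>F. inv h \<otimes> x \<in> U)"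
proof -
  define c where "c h = {x \<in> carrier G. inv h \<otimes> x \<in> U}" for h
  have c: "openin T (c h)" if "h \<in> H" for h
    unfolding c_def
    by (rule openin_vimage[OF _ U(1)]) (use H that in \<open>auto intro!: continuous_map_group\<close>)
  have "\<exists>h\<in>H. x \<in> c h" if x: "x \<in> carrier G" for x
  proof -
    \<comment> \<open>Density is applied to the condition on \<open>h\<close> with \<open>x\<close>
      fixed: it is open and holds at \<open>h = x\<close>.\<close>
    have "openin T {h \<in> carrier G. inv h \<otimes> x \<in> U}"
      by (rule openin_vimage[OF _ U(1)]) (use x in \<open>auto intro!: continuous_map_group\<close>)
    moreover have "x \<in> {h \<in> carrier G. inv h \<otimes> x \<in> U}" using x U by simp
    moreover have "x \<in> T closure_of H" using x H by (simp add: topspace_eq)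
    ultimately obtain h where "h \<in> H" "h \<in> {h \<in> carrier G. inv h \<otimes> x \<in> U}"
      by (meson in_closure_of)
    then show ?thesis using x by (auto simp: c_def)
  qed
  then have "topspace T \<subseteq> \<Union>(c ` H)" by (auto simp: topspace_eq)
  moreover have "\<forall>V\<in>c ` H. openin T V" using c by blast
  ultimately obtain \<F> where "finite \<F>" "\<F> \<subseteq> c ` H" "topspace T \<subseteq> \<Union>\<F>"
    using assms(1) unfolding compact_space_alt by meson
  then obtain F where "finite F" "F \<subseteq> H" "topspace T \<subseteq> \<Union>(c ` F)"
    by (metis finite_subset_image)
  then show ?thesis by (intro exI[of _ F]) (auto simp: c_def topspace_eq)
qed

text \<open>The hypothesis \<open>narrow\<close> is \<omega>-narrowness. Translating the members of
  a countable local base at the identity by the countable sets that it provides yields a countable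
  base.\<close>

lemma (in topological_group) second_countableI:
  assumes W: "countable W" "\<And>V. V \<in> W \<Longrightarrow> openin T V"
    and base: "\<And>U. openin T U \<Longrightarrow> \<one> \<in> U \<Longrightarrow> \<exists>V\<in>W. \<one> \<in> V \<and> V \<subseteq> U"
    and narrow: "\<And>U. openin T U \<Longrightarrow> \<one> \<in> U \<Longrightarrow>
      \<exists>F. countable F \<and> F \<subseteq> carrier G \<and> (\<forall>x\<in>carrier G. \<exists>h\<in>F. inv h \<otimes> x \<in> U)"
  shows "second_countable T"
proof -
  define W1 where "W1 = {V \<in> W. \<one> \<in> V}"
  have "\<forall>V\<in>W1. \<exists>F. countable F \<and> F \<subseteq> carrier G \<and> (\<forall>x\<in>carrier G. \<exists>h\<in>F. inv h \<otimes> x \<in> V)"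
    using W(2) by (intro ballI narrow) (auto simp: W1_def)
  then obtain F where "\<forall>V\<in>W1. countable (F V) \<and> F V \<subseteq> carrier G \<and>
      (\<forall>x\<in>carrier G. \<exists>h\<in>F V. inv h \<otimes> x \<in> V)"
    by (rule bchoice[THEN exE])
  then have F: "\<And>V. V \<in> W1 \<Longrightarrow> countable (F V)" "\<And>V. V \<in> W1 \<Longrightarrow> F V \<subseteq> carrier G"
    "\<And>V x. V \<in> W1 \<Longrightarrow> x \<in> carrier G \<Longrightarrow> \<exists>h\<in>F V. inv h \<otimes> x \<in> V"
    by simp_all
  define B where "B = (\<Union>V\<in>W1. (\<lambda>h. {x \<in> carrier G. inv h \<otimes> x \<in> V}) ` F V)"
  have "countable B" unfolding B_def using W F by (auto simp: W1_def)
  moreover have "openin T P" if "P \<in> B" for P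
    using that F(2) W(2) unfolding B_def W1_def
    by (auto intro!: openin_vimage continuous_map_group)
  moreover have "\<exists>V\<in>B. x \<in> V \<and> V \<subseteq> U" if U: "openin T U" "x \<in> U" for U x
  proof -
    have x: "x \<in> carrier G" using U openin_carrier by blast
    \<comment> \<open>Below, \<open>u = inv h \<otimes> x\<close> and
      \<open>v = inv h \<otimes> y\<close> turn this word into \<open>y\<close>, so the translate of
      \<open>V\<close> by \<open>h\<close> that contains \<open>x\<close> lies in
      \<open>U\<close>.\<close>
    have "continuous_map (prod_topology T T) T (\<lambda>z. x \<otimes> (inv (fst z) \<otimes> snd z))"
      by (intro continuous_map_group x)
    moreover have "x \<otimes> (inv \<one> \<otimes> \<one>) \<in> U" using x U by simp
    ultimately obtain A C where AC: "openin T A" "\<one> \<in> A" "openin T C" "\<one> \<in> C"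
      "\<And>u v. u \<in> A \<Longrightarrow> v \<in> C \<Longrightarrow> x \<otimes> (inv u \<otimes> v) \<in> U"
      by (rule continuous_map_nbhd2[OF _ U(1) _ one_closed one_closed, where f = "\<lambda>u v. x \<otimes> (inv u \<otimes> v)"]) auto
    moreover have "\<exists>V\<in>W. \<one> \<in> V \<and> V \<subseteq> A \<inter> C"
      by (rule base) (use AC in auto)
    ultimately obtain V where V: "V \<in> W1" "V \<subseteq> A \<inter> C"
      unfolding W1_def by auto
    obtain h where h: "h \<in> F V" "inv h \<otimes> x \<in> V" using F(3)[OF V(1) x] by blast
    have hc: "h \<in> carrier G" using F(2)[OF V(1)] h by blast
    have "y \<in> U" if y: "y \<in> carrier G" "inv h \<otimes> y \<in> V" for y
    proof -
      have "x \<otimes> (inv (inv h \<otimes> x) \<otimes> (inv h \<otimes> y)) \<in> U"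
        by (rule AC(5)) (use V h y in auto)
      moreover have "x \<otimes> (inv (inv h \<otimes> x) \<otimes> (inv h \<otimes> y)) = y"
        using x y hc by (simp add: inv_mult_group m_assoc mult_inv_cancel)
      ultimately show ?thesis by simp
    qed
    then have "{y \<in> carrier G. inv h \<otimes> y \<in> V} \<subseteq> U" by blast
    moreover have "{y \<in> carrier G. inv h \<otimes> y \<in> V} \<in> B"
      unfolding B_def by (intro UN_I[OF V(1)] imageI h(1))
    ultimately show ?thesis using h x by (intro bexI[of _ "{y \<in> carrier G. inv h \<otimes> y \<in> V}"]) auto
  qed
  ultimately show ?thesis unfolding second_countable_def by (intro exI[of _ B]) auto
qed

lemma (in topological_group) compact_second_countableI:
  assumes "compact_space T"
    and W: "countable W" "\<And>V. V \<in> W \<Longrightarrow> openin T V"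
    and base: "\<And>U. openin T U \<Longrightarrow> \<one> \<in> U \<Longrightarrow> \<exists>V\<in>W. \<one> \<in> V \<and> V \<subseteq> U"
  shows "second_countable T"
proof (rule second_countableI[OF W base])
  fix U assume U: "openin T U" "\<one> \<in> U"
  have "T closure_of carrier G = topspace T"
    using closure_of_topspace[of T] by (simp add: topspace_eq)
  from finite_translates_cover[OF assms(1) order_refl this U]
  show "\<exists>F. countable F \<and> F \<subseteq> carrier G \<and> (\<forall>x\<in>carrier G. \<exists>h\<in>F. inv h \<otimes> x \<in> U)"
    using countable_finite by fast
qed

subsection \<open>Metrizability of second countable compact spaces\<close>

text \<open>Urysohn functions for the countably many pairs of basic sets, the closure of one inside
  the other, separate points. They map \<open>X\<close> injectively and continuously into a
  countable power of the real line, and compactness turns this map into an embedding.\<close>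

lemma compact_Hausdorff_second_countable_imp_metrizable:
  assumes X: "compact_space X" "Hausdorff_space X" "second_countable X"
  shows "metrizable_space X"
proof -
  have norm: "normal_space X" and reg: "regular_space X"
    using X by (simp_all add: compact_Hausdorff_or_regular_imp_normal_space compact_Hausdorff_imp_regular_space)
  obtain B where B: "countable B" "\<And>V. V \<in> B \<Longrightarrow> openin X V"
    "\<And>U x. openin X U \<Longrightarrow> x \<in> U \<Longrightarrow> \<exists>V\<in>B. x \<in> V \<and> V \<subseteq> U"
    using X(3) unfolding second_countable_def by metis
  define I where "I = {(U, V). U \<in> B \<and> V \<in> B \<and> X closure_of U \<subseteq> V}"
  have "countable I"
    by (rule countable_subset[of _ "B \<times> B"]) (auto simp: I_def B)
  have "\<exists>f. continuous_map X euclideanreal f \<and> f ` (X closure_of fst p) \<subseteq> {0} \<and>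
      f ` (topspace X - snd p) \<subseteq> {1}" if "p \<in> I" for p
    by (rule Urysohn_lemma_alt[OF norm, of "X closure_of fst p" "topspace X - snd p" 0 1])
      (use that B in \<open>auto simp: I_def disjnt_iff\<close>)
  then obtain f where f: "\<And>p. p \<in> I \<Longrightarrow> continuous_map X euclideanreal (f p)"
    "\<And>p. p \<in> I \<Longrightarrow> f p ` (X closure_of fst p) \<subseteq> {0}"
    "\<And>p. p \<in> I \<Longrightarrow> f p ` (topspace X - snd p) \<subseteq> {1}"
    by metis
  let ?Y = "product_topology (\<lambda>_. euclideanreal) I"
  define g where "g x = (\<lambda>p\<in>I. f p x)" for x
  have "continuous_map X ?Y g"
    unfolding continuous_map_componentwise g_def using f(1) by auto
  moreover have metY: "metrizable_space ?Y"
    by (rule metrizable_topology_D)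
      (auto intro: countable_subset[OF _ \<open>countable I\<close>] simp: metrizable_space_euclidean PiE_eq_empty_iff)
  moreover have "inj_on g (topspace X)"
  proof (rule inj_onI, rule ccontr)
    fix x y assume xy: "x \<in> topspace X" "y \<in> topspace X" "g x = g y" "x \<noteq> y"
    then obtain V0 where "openin X V0" "x \<in> V0" "y \<notin> V0"
      using X(2) unfolding Hausdorff_space_def by (metis disjnt_iff)
    then obtain V where V: "V \<in> B" "x \<in> V" "y \<notin> V" using B(3) by blast
    have "openin X V" using B(2) V(1) .
    then obtain U0 C where U0: "openin X U0" "closedin X C" "x \<in> U0" "U0 \<subseteq> C" "C \<subseteq> V"
      using reg V(2) unfolding neighbourhood_base_of_closedin[symmetric] neighbourhood_base_of by metis
    obtain U where U: "U \<in> B" "x \<in> U" "U \<subseteq> U0" using B(3)[OF U0(1,3)] by auto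
    then have "X closure_of U \<subseteq> C" using U0 by (intro closure_of_minimal) auto
    then have UV: "X closure_of U \<subseteq> V" using U0(5) by simp
    then have p: "(U, V) \<in> I" using V U UV by (simp add: I_def)
    have "x \<in> X closure_of U" using U B by (meson closure_of_subset openin_subset subsetD)
    then have "f (U, V) x = 0" using f(2)[OF p] by auto
    moreover have "f (U, V) y = 1" using f(3)[OF p] xy V by auto
    ultimately show False using fun_cong[OF xy(3), of "(U, V)"] p by (simp add: g_def)
  qed
  ultimately have "embedding_map X ?Y g"
    using X continuous_imp_embedding_map metrizable_imp_Hausdorff_space by blast
  then have "X homeomorphic_space subtopology ?Y (g ` topspace X)"
    using embedding_map_imp_homeomorphic_space by blast
  then show ?thesis
    using metY homeomorphic_metrizable_space metrizable_space_subtopology by blast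
qed

subsection \<open>Subgroups and quotients\<close>

lemma (in topological_group) subgroup_topological_group:
  assumes H: "subgroup H G"
  shows "topological_group (G\<lparr>carrier := H\<rparr>) (subtopology T H)"
proof (intro topological_group.intro topological_group_axioms.intro)
  show "group (G\<lparr>carrier := H\<rparr>)" by (rule subgroup_imp_group[OF H])
  have HG: "H \<subseteq> carrier G" using H by (rule subgroup.subset)
  then show "topspace (subtopology T H) = carrier (G\<lparr>carrier := H\<rparr>)"
    by (auto simp: topspace_eq)
  have "continuous_map (subtopology (prod_topology T T) (H \<times> H)) (subtopology T H) (\<lambda>(x, y). x \<otimes> y)"
    using continuous_map_from_subtopology[OF continuous_mult] subgroup.m_closed[OF H]
    by (auto simp: continuous_map_in_subtopology)
  then show "continuous_map (prod_topology (subtopology T H) (subtopology T H)) (subtopology T H)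
      (\<lambda>(x, y). x \<otimes>\<^bsub>G\<lparr>carrier := H\<rparr>\<^esub> y)"
    by (simp add: subtopology_Times)
  have "continuous_map (subtopology T H) (subtopology T H) (\<lambda>x. inv x)"
    using continuous_map_from_subtopology[OF continuous_inv] subgroup.m_inv_closed[OF H]
    by (auto simp: continuous_map_in_subtopology)
  then show "continuous_map (subtopology T H) (subtopology T H) (\<lambda>x. inv\<^bsub>G\<lparr>carrier := H\<rparr>\<^esub> x)"
    by (rule continuous_map_eq) (simp add: H)
  show "Hausdorff_space (subtopology T H)"
    by (rule Hausdorff_space_subtopology[OF Hausdorff])
qed

definition quotient_topology :: "'a topology \<Rightarrow> ('a \<Rightarrow> 'b) \<Rightarrow> 'b topology"
  where "quotient_topology X f =
    topology (\<lambda>V. V \<subseteq> f ` topspace X \<and> openin X {x \<in> topspace X. f x \<in> V})"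

lemma openin_quotient_topology:
  "openin (quotient_topology X f) V \<longleftrightarrow> V \<subseteq> f ` topspace X \<and> openin X {x \<in> topspace X. f x \<in> V}"
proof -
  have "openin X {x \<in> topspace X. f x \<in> V \<inter> W}"
    if "openin X {x \<in> topspace X. f x \<in> V}" "openin X {x \<in> topspace X. f x \<in> W}" for V W
    using openin_Int[OF that] by (rule back_subst[of "openin X"]) auto
  moreover have "openin X {x \<in> topspace X. f x \<in> \<Union>\<V>}"
    if "\<forall>V\<in>\<V>. openin X {x \<in> topspace X. f x \<in> V}" for \<V>
  proof -
    have "{x \<in> topspace X. f x \<in> \<Union>\<V>} = \<Union>((\<lambda>V. {x \<in> topspace X. f x \<in> V}) ` \<V>)" by auto
    then show ?thesis using that by auto
  qed
  ultimately have "istopology (\<lambda>V. V \<subseteq> f ` topspace X \<and> openin X {x \<in> topspace X. f x \<in> V})"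
    unfolding istopology_def by (intro conjI allI impI) (fastforce, fast, fast, blast)
  then show ?thesis by (simp add: quotient_topology_def)
qed

lemma topspace_quotient_topology [simp]: "topspace (quotient_topology X f) = f ` topspace X"
proof
  have "{x \<in> topspace X. f x \<in> f ` topspace X} = topspace X" by auto
  then have "openin (quotient_topology X f) (f ` topspace X)"
    by (simp add: openin_quotient_topology)
  then show "f ` topspace X \<subseteq> topspace (quotient_topology X f)" by (rule openin_subset)
  have "openin (quotient_topology X f) (topspace (quotient_topology X f))" by (rule openin_topspace)
  then show "topspace (quotient_topology X f) \<subseteq> f ` topspace X"
    by (simp only: openin_quotient_topology)
qed

lemma quotient_map_quotient_topology: "quotient_map X (quotient_topology X f) f"
  by (simp add: quotient_map_def openin_quotient_topology)

lemma (in normal) r_coset_eq_iff: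
  assumes "a \<in> carrier G" "b \<in> carrier G"
  shows "H #> a = H #> b \<longleftrightarrow> a \<otimes> inv b \<in> H"
proof -
  have "H #> a = H #> b \<longleftrightarrow> a \<in> H #> b"
    using assms rcos_self[OF _ subgroup_axioms] repr_independence[OF _ _ subgroup_axioms] by metis
  then show ?thesis using rcos_module[OF group_axioms] assms by simp
qed

abbreviation coset_topology :: "('a, 'm) monoid_scheme \<Rightarrow> 'a topology \<Rightarrow> 'a set \<Rightarrow> 'a set topology"
  where "coset_topology G T N \<equiv> quotient_topology T (\<lambda>x. N #>\<^bsub>G\<^esub> x)"

text \<open>The projection is open because the saturation of \<open>U\<close> is a union of left
  translates of \<open>U\<close> by elements of \<open>N\<close>.\<close>

lemma (in topological_group) openin_coset_image:
  assumes N: "N \<lhd> G" and U: "openin T U"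
  shows "openin (coset_topology G T N) ((\<lambda>x. N #> x) ` U)"
proof -
  interpret N: normal N G by (rule N)
  have UG: "U \<subseteq> carrier G" by (rule openin_carrier[OF U])
  have key: "N #> x \<in> (\<lambda>x. N #> x) ` U \<longleftrightarrow> (\<exists>n\<in>N. n \<otimes> x \<in> U)" if x: "x \<in> carrier G" for x
  proof
    assume "N #> x \<in> (\<lambda>x. N #> x) ` U"
    then obtain u where u: "u \<in> U" "N #> u = N #> x" by auto
    then have "u \<in> N #> x" using UG rcos_self[OF _ N.subgroup_axioms] by auto
    then show "\<exists>n\<in>N. n \<otimes> x \<in> U" using u by (auto simp: r_coset_def)
  next
    assume "\<exists>n\<in>N. n \<otimes> x \<in> U"
    then obtain n where n: "n \<in> N" "n \<otimes> x \<in> U" by auto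
    then have "N #> (n \<otimes> x) = N #> x"
      using x by (simp add: N.r_coset_eq_iff m_assoc)
    then show "N #> x \<in> (\<lambda>x. N #> x) ` U" using n by (metis imageI)
  qed
  have "{x \<in> topspace T. N #> x \<in> (\<lambda>x. N #> x) ` U} = (\<Union>n\<in>N. {x \<in> carrier G. n \<otimes> x \<in> U})"
    unfolding topspace_eq by (rule Set.set_eqI) (simp add: key cong: conj_cong del: image_iff)
  also have "openin T \<dots>"
    by (intro openin_Union ballI) (auto intro!: openin_vimage[OF _ U] continuous_map_group)
  finally show ?thesis using UG by (auto simp: openin_quotient_topology topspace_eq)
qed

text \<open>Since the projection is open, it carries open rectangles of \<open>G\<close> to open
  rectangles of the quotient. This makes multiplication continuous, although a product of quotient
  maps need not be a quotient map. For the Hausdorff property, the cosets of \<open>x\<close> and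
  \<open>y\<close> differ exactly when \<open>x \<otimes> inv y\<close> lies in the open complement
  of \<open>N\<close>.\<close>

lemma (in topological_group) quotient_topological_group:
  assumes N: "N \<lhd> G" and cl: "closedin T N"
  shows "topological_group (G Mod N) (coset_topology G T N)"
proof (intro topological_group.intro topological_group_axioms.intro)
  interpret N: normal N G by (rule N)
  let ?Q = "coset_topology G T N" and ?p = "\<lambda>x. N #> x"
  have quot: "quotient_map T ?Q ?p" by (rule quotient_map_quotient_topology)
  show "group (G Mod N)" by (rule N.factorgroup_is_group)
  show top: "topspace ?Q = carrier (G Mod N)"
    by (simp add: topspace_eq carrier_FactGroup)
  have im: "X \<in> topspace ?Q \<Longrightarrow> \<exists>x\<in>carrier G. X = ?p x" for X
    by (auto simp: topspace_eq)
  show "continuous_map (prod_topology ?Q ?Q) ?Q (\<lambda>(x, y). x \<otimes>\<^bsub>G Mod N\<^esub> y)"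
    unfolding continuous_map_def
  proof (intro conjI allI impI)
    show "(\<lambda>(x, y). x \<otimes>\<^bsub>G Mod N\<^esub> y) \<in> topspace (prod_topology ?Q ?Q) \<rightarrow> topspace ?Q"
      by (auto simp: topspace_eq N.rcos_sum)
    fix V assume V: "openin ?Q V"
    let ?V = "{x \<in> carrier G. ?p x \<in> V}"
    let ?W = "{z \<in> topspace (prod_topology ?Q ?Q). (case z of (x, y) \<Rightarrow> x \<otimes>\<^bsub>G Mod N\<^esub> y) \<in> V}"
    have V': "openin T ?V" using V by (simp add: openin_quotient_topology topspace_eq)
    have "\<exists>A B. openin ?Q A \<and> openin ?Q B \<and> X \<in> A \<and> Y \<in> B \<and> A \<times> B \<subseteq> ?W"
      if XY: "(X, Y) \<in> ?W" for X Y
    proof -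
      obtain x y where xy: "x \<in> carrier G" "y \<in> carrier G" "X = ?p x" "Y = ?p y"
        using im[of X] im[of Y] XY by auto
      then have xyV: "x \<otimes> y \<in> ?V" using XY by (simp add: N.rcos_sum)
      have "continuous_map (prod_topology T T) T (\<lambda>z. fst z \<otimes> snd z)"
        by (intro continuous_map_group)
      then obtain A B where AB: "openin T A" "x \<in> A" "openin T B" "y \<in> B"
        "\<And>u v. u \<in> A \<Longrightarrow> v \<in> B \<Longrightarrow> u \<otimes> v \<in> ?V"
        by (rule continuous_map_nbhd2[where f = "\<lambda>u v. u \<otimes> v", OF _ V' xyV xy(1,2)]) auto
      have "?p u <#> ?p v \<in> V" if "u \<in> A" "v \<in> B" for u v
        using AB(5)[OF that] openin_carrier[OF AB(1)] openin_carrier[OF AB(3)] that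
        by (auto simp: N.rcos_sum subset_iff)
      then have "?p ` A \<times> ?p ` B \<subseteq> ?W"
        using openin_carrier[OF AB(1)] openin_carrier[OF AB(3)] by (auto simp: topspace_eq)
      then show ?thesis
        using AB(2,4) xy(3,4) openin_coset_image[OF N AB(1)] openin_coset_image[OF N AB(3)]
        by (intro exI[of _ "?p ` A"] exI[of _ "?p ` B"]) auto
    qed
    then show "openin (prod_topology ?Q ?Q) ?W"
      unfolding openin_prod_topology_alt by simp
  qed
  have "continuous_map T ?Q (?p \<circ> (\<lambda>x. inv x))"
    by (rule continuous_map_compose[OF continuous_inv quotient_imp_continuous_map[OF quot]])
  then have "continuous_map T ?Q ((\<lambda>X. inv\<^bsub>G Mod N\<^esub> X) \<circ> ?p)"
    by (rule continuous_map_eq) (simp add: topspace_eq N.inv_FactGroup carrier_FactGroup N.rcos_inv)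
  then show "continuous_map ?Q ?Q (\<lambda>X. inv\<^bsub>G Mod N\<^esub> X)"
    by (rule continuous_compose_quotient_map[OF quot])
  show "Hausdorff_space ?Q"
    unfolding Hausdorff_space_def
  proof (intro allI impI)
    fix X Y assume XY: "X \<in> topspace ?Q \<and> Y \<in> topspace ?Q \<and> X \<noteq> Y"
    then obtain x y where xy: "x \<in> carrier G" "y \<in> carrier G" "X = ?p x" "Y = ?p y"
      using im[of X] im[of Y] by auto
    have op: "openin T (carrier G - N)" using cl by (metis openin_diff openin_topspace topspace_eq)
    have ne: "x \<otimes> inv y \<in> carrier G - N" using XY xy N.r_coset_eq_iff by simp
    have "continuous_map (prod_topology T T) T (\<lambda>z. fst z \<otimes> inv (snd z))"
      by (intro continuous_map_group)
    then obtain A B where AB: "openin T A" "x \<in> A" "openin T B" "y \<in> B"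
      "\<And>u v. u \<in> A \<Longrightarrow> v \<in> B \<Longrightarrow> u \<otimes> inv v \<in> carrier G - N"
      by (rule continuous_map_nbhd2[where f = "\<lambda>u v. u \<otimes> inv v", OF _ op ne xy(1,2)]) auto
    have "?p u \<noteq> ?p v" if "u \<in> A" "v \<in> B" for u v
      using AB(5)[OF that] that openin_carrier[OF AB(1)] openin_carrier[OF AB(3)]
      by (auto simp: N.r_coset_eq_iff subset_iff)
    then have "disjnt (?p ` A) (?p ` B)" by (auto simp: disjnt_iff)
    then show "\<exists>U V. openin ?Q U \<and> openin ?Q V \<and> X \<in> U \<and> Y \<in> V \<and> disjnt U V"
      using AB(2,4) xy(3,4) openin_coset_image[OF N AB(1)] openin_coset_image[OF N AB(3)]
      by (intro exI[of _ "?p ` A"] exI[of _ "?p ` B"]) auto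
  qed
qed

subsection \<open>Images of dense subgroups of metrizable groups\<close>

lemma second_countable_imp_arhangelskii:
  assumes "Hausdorff_space X" "second_countable X"
  shows "arhangelskii X"
proof -
  obtain B where B: "weight X = |B|" "\<And>B'. topology_base X B' \<Longrightarrow> |B| \<le>o |B'|"
    using weight_least[of X] by auto
  have "|B| \<le>o |topspace X|"
  proof (cases "finite (topspace X)")
    case True
    \<comment> \<open>The weight is exact, so a countable base is not enough for a finite space. The
      singletons form a base with as many members as there are points.\<close>
    then have "X = discrete_topology (topspace X)"
      using finite_t1_space_imp_discrete_topology Hausdorff_imp_t1_space assms(1) by metis
    then have "openin X U \<longleftrightarrow> U \<subseteq> topspace X" for U
      by (metis openin_discrete_topology)
    then have "topology_base X ((\<lambda>x. {x}) ` topspace X)"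
      unfolding topology_base_def openin_topology_base_unique by auto
    then show ?thesis
      using B(2) card_of_image ordLeq_transitive by metis
  next
    case False
    obtain C where C: "countable C" "topology_base X C"
      using assms(2) unfolding second_countable topology_base_def by auto
    have "|C| \<le>o |UNIV :: nat set|" using C(1) by (simp add: countable_card_of_nat)
    also have "|UNIV :: nat set| \<le>o |topspace X|"
      using False by (simp add: infinite_iff_card_of_nat)
    finally show ?thesis using B(2)[OF C(2)] ordLeq_transitive by metis
  qed
  then show ?thesis by (simp add: arhangelskii_def B(1))
qed

lemma countable_arhangelskii_imp_second_countable:
  assumes "arhangelskii X" "countable (topspace X)"
  shows "second_countable X"
proof -
  obtain B where B: "topology_base X B" "weight X = |B|"
    using weight_least[of X] by auto
  then have "|B| \<le>o |topspace X|" using assms(1) by (simp add: arhangelskii_def)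
  then have "|B| \<le>o |UNIV :: nat set|"
    using assms(2) ordLeq_transitive by (metis countable_card_of_nat)
  then have "countable B" by (simp add: countable_card_of_nat)
  then show ?thesis using B(1) by (auto simp: second_countable topology_base_def)
qed

text \<open>If \<open>V \<cdot> V \<subseteq> U\<close>, then every point of the closure \<open>C\<close> of the preimage of \<open>V\<close> has a neighbourhood
  whose trace on \<open>H\<close> is mapped into \<open>U\<close>. As \<open>C\<close> is compact, finitely many basic sets lie between
  \<open>C\<close> and the preimage of \<open>U\<close>, so the interiors of the images of finite unions of basic sets are
  a local base at the identity.\<close>

lemma (in topological_group) dense_subgroup_image_second_countable:
  fixes K :: "('b, 'n) monoid_scheme"
  assumes cpt: "compact_space T" and sc: "second_countable T"
    and H: "subgroup H G" and dense: "T closure_of H = topspace T"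
    and K: "topological_group K S"
    and f: "f \<in> epi (G\<lparr>carrier := H\<rparr>) K" and cont: "continuous_map (subtopology T H) S f"
  shows "second_countable S"
proof -
  interpret K: topological_group K S by (rule K)
  have HG: "H \<subseteq> carrier G" using H by (rule subgroup.subset)
  have fH: "f ` H = carrier K" using f by (simp add: epi_def)
  interpret f: group_hom "G\<lparr>carrier := H\<rparr>" K f
    using f by (intro group_hom.intro group_hom_axioms.intro subgroup_imp_group[OF H] K.group_axioms)
      (simp add: epi_def)
  have inv_closed_H: "inv x \<in> H" if "x \<in> H" for x using H that by (rule subgroup.m_inv_closed)
  have mult_closed_H: "x \<otimes> y \<in> H" if "x \<in> H" "y \<in> H" for x y using H that by (rule subgroup.m_closed)
  have fmult: "f (x \<otimes> y) = f x \<otimes>\<^bsub>K\<^esub> f y" if "x \<in> H" "y \<in> H" for x y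
    using f.hom_mult[of x y] that by simp
  have finv: "f (inv x) = inv\<^bsub>K\<^esub> (f x)" if "x \<in> H" for x
    using f.hom_inv[of x] that H by simp
  have fone: "f \<one> = \<one>\<^bsub>K\<^esub>" using f.hom_one by simp
  have oneH: "\<one> \<in> H" using H by (rule subgroup.one_closed)
  have fK: "f x \<in> carrier K" if "x \<in> H" for x using fH that by blast
  have pre: "\<exists>P. openin T P \<and> (\<forall>x\<in>H. x \<in> P \<longleftrightarrow> f x \<in> V)" if V: "openin S V" for V
  proof -
    have "openin (subtopology T H) {x \<in> topspace (subtopology T H). f x \<in> V}"
      using cont V by (rule openin_continuous_map_preimage)
    then obtain P where "openin T P" "{x \<in> topspace (subtopology T H). f x \<in> V} = P \<inter> H"
      unfolding openin_subtopology by auto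
    then show ?thesis using HG by (intro exI[of _ P]) (auto simp: topspace_eq)
  qed
  obtain B where B: "countable B" "\<And>V. V \<in> B \<Longrightarrow> openin T V"
    "\<And>U x. openin T U \<Longrightarrow> x \<in> U \<Longrightarrow> \<exists>V\<in>B. x \<in> V \<and> V \<subseteq> U"
    using sc unfolding second_countable_def by auto
  \<comment> \<open>The map \<open>f\<close> need not be open, so the image of a trace on
    \<open>H\<close> is replaced by its interior.\<close>
  define W where "W = (\<lambda>F. S interior_of (f ` (\<Union>F \<inter> H))) ` {F. F \<subseteq> B \<and> finite F}"
  show ?thesis
  proof (rule K.second_countableI[of W])
    show "countable W"
      unfolding W_def using countable_Collect_finite_subset[OF B(1)]
      by (intro countable_image) (simp add: conj_commute)
    show "openin S V" if "V \<in> W" for V using that by (auto simp: W_def)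
    fix U assume U: "openin S U" "\<one>\<^bsub>K\<^esub> \<in> U"
    show "\<exists>V\<in>W. \<one>\<^bsub>K\<^esub> \<in> V \<and> V \<subseteq> U"
    proof -
      have "continuous_map (prod_topology S S) S (\<lambda>z. fst z \<otimes>\<^bsub>K\<^esub> snd z)"
        by (intro K.continuous_map_group)
      moreover have "\<one>\<^bsub>K\<^esub> \<otimes>\<^bsub>K\<^esub> \<one>\<^bsub>K\<^esub> \<in> U" using U by simp
      ultimately obtain V1 V2 where V12: "openin S V1" "\<one>\<^bsub>K\<^esub> \<in> V1" "openin S V2" "\<one>\<^bsub>K\<^esub> \<in> V2"
        "\<And>x y. x \<in> V1 \<Longrightarrow> y \<in> V2 \<Longrightarrow> x \<otimes>\<^bsub>K\<^esub> y \<in> U"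
        by (rule K.continuous_map_nbhd2[where f = "\<lambda>u v. u \<otimes>\<^bsub>K\<^esub> v", OF _ U(1) _ K.one_closed K.one_closed]) auto
      define V where "V = V1 \<inter> V2"
      have V: "openin S V" "\<one>\<^bsub>K\<^esub> \<in> V" using V12 by (auto simp: V_def)
      have VU: "x \<otimes>\<^bsub>K\<^esub> y \<in> U" if "x \<in> V" "y \<in> V" for x y
        by (rule V12(5)) (use that in \<open>auto simp: V_def\<close>)
      from pre[OF V(1)] obtain P where P: "openin T P" "\<And>x. x \<in> H \<Longrightarrow> x \<in> P \<longleftrightarrow> f x \<in> V"
        by auto
      have "continuous_map (prod_topology T T) T (\<lambda>z. inv (fst z) \<otimes> snd z)"
        by (intro continuous_map_group)
      moreover have "inv \<one> \<otimes> \<one> \<in> P" using V P(2) oneH fone by simp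
      ultimately obtain Q1 Q2 where Q12: "openin T Q1" "\<one> \<in> Q1" "openin T Q2" "\<one> \<in> Q2"
        "\<And>x y. x \<in> Q1 \<Longrightarrow> y \<in> Q2 \<Longrightarrow> inv x \<otimes> y \<in> P"
        by (rule continuous_map_nbhd2[where f = "\<lambda>u v. inv u \<otimes> v", OF _ P(1) _ one_closed one_closed]) auto
      define Q where "Q = Q1 \<inter> Q2"
      have Q: "openin T Q" "\<one> \<in> Q" using Q12 by (auto simp: Q_def)
      have QP: "inv x \<otimes> y \<in> P" if "x \<in> Q" "y \<in> Q" for x y
        by (rule Q12(5)) (use that in \<open>auto simp: Q_def\<close>)
      define C where "C = T closure_of (P \<inter> H)"
      define \<U> where "\<U> = {b \<in> B. \<forall>p\<in>b \<inter> H. f p \<in> U}"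
      have "compactin T C"
        unfolding C_def using cpt closedin_closure_of by (rule closedin_compact_space)
      moreover have "openin T b" if "b \<in> \<U>" for b using that B(2) by (auto simp: \<U>_def)
      moreover have "C \<subseteq> \<Union>\<U>"
      proof
        fix c assume c: "c \<in> C"
        then have cG: "c \<in> carrier G"
          unfolding C_def using closure_of_subset_topspace topspace_eq by fast
        \<comment> \<open>\<open>R\<close> is the translate of \<open>Q\<close> by \<open>c\<close>.
          If \<open>w\<close> and \<open>p\<close> lie in it, then \<open>inv w \<otimes> p\<close>
          lies in \<open>P\<close>. With \<open>w\<close> in \<open>P\<close>, and both in
          \<open>H\<close>, this writes \<open>f p\<close> as the product of \<open>f w\<close> and
          \<open>f (inv w \<otimes> p)\<close>, two elements of \<open>V\<close>.\<close>
        define R where "R = {p \<in> carrier G. inv c \<otimes> p \<in> Q}"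
        have R: "openin T R" unfolding R_def
          by (rule openin_vimage[OF _ Q(1)]) (use cG in \<open>auto intro!: continuous_map_group\<close>)
        moreover have cR: "c \<in> R" using cG Q by (simp add: R_def)
        ultimately obtain w where w: "w \<in> P" "w \<in> H" "w \<in> R"
          using c unfolding C_def in_closure_of by auto
        have "f p \<in> U" if p: "p \<in> R" "p \<in> H" for p
        proof -
          have wp: "w \<in> carrier G" "p \<in> carrier G" using HG w p by auto
          have "inv (inv c \<otimes> w) \<otimes> (inv c \<otimes> p) \<in> P"
            by (rule QP) (use w p in \<open>auto simp: R_def\<close>)
          then have "inv w \<otimes> p \<in> P"
            using wp cG by (simp add: inv_mult_group m_assoc mult_inv_cancel)
          then have "f (inv w \<otimes> p) \<in> V"
            using P(2) mult_closed_H inv_closed_H w p by simp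
          then have "f w \<otimes>\<^bsub>K\<^esub> f (inv w \<otimes> p) \<in> U"
            using P(2) w by (intro VU) simp_all
          moreover have "f w \<otimes>\<^bsub>K\<^esub> f (inv w \<otimes> p) = f p"
            using fmult[of w "inv w \<otimes> p"] w p mult_closed_H inv_closed_H wp
            by (simp add: mult_inv_cancel)
          ultimately show ?thesis by simp
        qed
        moreover obtain b where "b \<in> B" "c \<in> b" "b \<subseteq> R" using B(3)[OF R cR] by auto
        ultimately show "c \<in> \<Union>\<U>" unfolding \<U>_def by (intro UnionI[of b]) auto
      qed
      ultimately have "\<exists>F. finite F \<and> F \<subseteq> \<U> \<and> C \<subseteq> \<Union>F" by (rule compactinD)
      then obtain F where F: "finite F" "F \<subseteq> \<U>" "C \<subseteq> \<Union>F" by auto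
      have "V \<subseteq> f ` (\<Union>F \<inter> H)"
      proof
        fix v assume v: "v \<in> V"
        then have "v \<in> f ` H" using K.openin_carrier[OF V(1)] fH by auto
        then obtain x where x: "x \<in> H" "f x = v" by auto
        then have "x \<in> P \<inter> H" using P(2) v by simp
        moreover have "P \<inter> H \<subseteq> C"
          unfolding C_def by (rule closure_of_subset) (use HG in \<open>auto simp: topspace_eq\<close>)
        ultimately have "x \<in> \<Union>F" using F(3) by auto
        then show "v \<in> f ` (\<Union>F \<inter> H)" using x by auto
      qed
      then have "V \<subseteq> S interior_of (f ` (\<Union>F \<inter> H))" using V(1) by (rule interior_of_maximal)
      moreover have "S interior_of (f ` (\<Union>F \<inter> H)) \<subseteq> f ` (\<Union>F \<inter> H)" by (rule interior_of_subset)
      moreover have "f ` (\<Union>F \<inter> H) \<subseteq> U" using F(2) by (auto simp: \<U>_def)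
      moreover have "F \<subseteq> B" using F(2) by (auto simp: \<U>_def)
      ultimately show ?thesis
        using V(2) F(1) by (intro bexI[of _ "S interior_of (f ` (\<Union>F \<inter> H))"]) (auto simp: W_def)
    qed
    show "\<exists>F. countable F \<and> F \<subseteq> carrier K \<and> (\<forall>x\<in>carrier K. \<exists>h\<in>F. inv\<^bsub>K\<^esub> h \<otimes>\<^bsub>K\<^esub> x \<in> U)"
    proof -
      from pre[OF U(1)] obtain P where P: "openin T P" "\<And>x. x \<in> H \<Longrightarrow> x \<in> P \<longleftrightarrow> f x \<in> U"
        by auto
      have "\<one> \<in> P" using P(2) oneH fone U by simp
      \<comment> \<open>Density places the finitely many translating elements in \<open>H\<close>,
        where \<open>f\<close> can be applied to them.\<close>
      from finite_translates_cover[OF cpt HG dense P(1) this]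
      obtain F where F: "finite F" "F \<subseteq> H" "\<And>x. x \<in> carrier G \<Longrightarrow> \<exists>h\<in>F. inv h \<otimes> x \<in> P" by auto
      have "\<exists>h\<in>f ` F. inv\<^bsub>K\<^esub> h \<otimes>\<^bsub>K\<^esub> x \<in> U" if "x \<in> carrier K" for x
      proof -
        have "x \<in> f ` H" using that fH by simp
        then obtain y where y: "y \<in> H" "x = f y" by auto
        then obtain h where h: "h \<in> F" "inv h \<otimes> y \<in> P" using F(3)[of y] HG by auto
        then have "h \<in> H" using F(2) by auto
        then have "inv\<^bsub>K\<^esub> f h \<otimes>\<^bsub>K\<^esub> f y \<in> U"
          using P(2)[of "inv h \<otimes> y"] h y mult_closed_H inv_closed_H finv fmult by simp
        then show ?thesis using h y by auto
      qed
      then show ?thesis using F fK by (intro exI[of _ "f ` F"]) (auto intro: countable_finite)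
    qed
  qed
qed

subsection \<open>Closed normal subgroups of countable character\<close>

text \<open>Otherwise all the closed sets \<open>C - U\<close> are nonempty. Every finite part of
  the chain has a lower bound in the chain, so they have the finite intersection property, and
  compactness yields a point of \<open>\<Inter>\<C>\<close> outside \<open>U\<close>.\<close>

lemma compact_space_chain_subset_open:
  assumes cpt: "compact_space X" and "\<C> \<noteq> {}" and cl: "\<And>C. C \<in> \<C> \<Longrightarrow> closedin X C"
    and chain: "\<And>C D. C \<in> \<C> \<Longrightarrow> D \<in> \<C> \<Longrightarrow> C \<subseteq> D \<or> D \<subseteq> C"
    and U: "openin X U" "\<Inter>\<C> \<subseteq> U"
  shows "\<exists>C\<in>\<C>. C \<subseteq> U"
proof (rule ccontr)
  assume contr: "\<not> (\<exists>C\<in>\<C>. C \<subseteq> U)"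
  have least: "\<exists>C\<in>\<C>. C \<subseteq> \<Inter>\<D>" if "finite \<D>" "\<D> \<subseteq> \<C>" for \<D>
    using that
  proof (induction \<D>)
    case empty
    then show ?case using \<open>\<C> \<noteq> {}\<close> by auto
  next
    case (insert D \<D>)
    then obtain C where C: "C \<in> \<C>" "C \<subseteq> \<Inter>\<D>" by auto
    have D: "D \<in> \<C>" using insert.prems by simp
    from chain[OF C(1) D] show ?case
    proof
      assume "C \<subseteq> D"
      then show ?thesis using C by (intro bexI[of _ C]) auto
    next
      assume "D \<subseteq> C"
      then show ?thesis using C D by (intro bexI[of _ D]) auto
    qed
  qed
  let ?\<U> = "(\<lambda>C. C - U) ` \<C>"
  have closed: "\<forall>C\<in>?\<U>. closedin X C" using cl U(1) by (auto intro: closedin_diff)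
  have fip: "\<Inter>\<F> \<noteq> {}" if F: "finite \<F>" "\<F> \<subseteq> ?\<U>" for \<F>
  proof -
    obtain \<D> where \<D>: "finite \<D>" "\<D> \<subseteq> \<C>" "\<F> = (\<lambda>C. C - U) ` \<D>"
      using finite_subset_image[OF F] by auto
    obtain C where "C \<in> \<C>" "C \<subseteq> \<Inter>\<D>" using least[OF \<D>(1,2)] by auto
    moreover have "\<not> C \<subseteq> U" using contr \<open>C \<in> \<C>\<close> by auto
    then obtain x where "x \<in> C" "x \<notin> U" by auto
    ultimately have "x \<in> \<Inter>\<F>" using \<D>(3) by auto
    then show ?thesis by auto
  qed
  have "\<Inter>?\<U> \<noteq> {}"
    by (rule cpt[unfolded compact_space_fip, THEN spec, THEN mp]) (intro conjI allI impI closed, elim conjE, rule fip)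
  then show False using U(2) \<open>\<C> \<noteq> {}\<close> by auto
qed

text \<open>For a closed normal subgroup of a compact group, this is metrizability of the quotient.
  Being stated in the group itself, it can be followed when subgroups are intersected.\<close>

definition countable_character :: "'a topology \<Rightarrow> 'a set \<Rightarrow> bool"
  where "countable_character X S \<longleftrightarrow>
    (\<exists>\<B>. countable \<B> \<and> (\<forall>V\<in>\<B>. openin X V) \<and>
      (\<forall>U. openin X U \<and> S \<subseteq> U \<longrightarrow> (\<exists>V\<in>\<B>. S \<subseteq> V \<and> V \<subseteq> U)))"

text \<open>The closed sets \<open>S \<inter> X closure_of V n\<close> decrease to the given
  intersection, so by compactness one of them already lies in a given open set around it.\<close>

lemma countable_character_Int_decreasing:
  fixes V :: "nat \<Rightarrow> 'a set"
  assumes cpt: "compact_space X" and S: "closedin X S" "countable_character X S"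
    and V: "\<And>n. openin X (V n)" "\<And>n. X closure_of V (Suc n) \<subseteq> V n"
  shows "countable_character X (S \<inter> (\<Inter>n. V n))"
proof -
  obtain \<B> where B: "countable \<B>" "\<And>A. A \<in> \<B> \<Longrightarrow> openin X A"
    "\<And>U. openin X U \<Longrightarrow> S \<subseteq> U \<Longrightarrow> \<exists>A\<in>\<B>. S \<subseteq> A \<and> A \<subseteq> U"
    using S(2) unfolding countable_character_def by auto
  let ?B = "(\<lambda>(A, n). A \<inter> V n) ` (\<B> \<times> (UNIV :: nat set))"
  have Vcl: "V n \<subseteq> X closure_of V n" for n by (rule closure_of_subset[OF openin_subset[OF V(1)]])
  have dec: "decseq (\<lambda>n. X closure_of V n)"
    by (rule decseq_SucI) (use V(2) Vcl in \<open>meson order_trans\<close>)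
  have "\<exists>A\<in>?B. S \<inter> (\<Inter>n. V n) \<subseteq> A \<and> A \<subseteq> U" if U: "openin X U" "S \<inter> (\<Inter>n. V n) \<subseteq> U" for U
  proof -
    have "\<exists>C\<in>range (\<lambda>n. S \<inter> X closure_of V n). C \<subseteq> U"
    proof (rule compact_space_chain_subset_open[OF cpt _ _ _ U(1)])
      show "range (\<lambda>n. S \<inter> X closure_of V n) \<noteq> {}" by simp
      show "closedin X C" if "C \<in> range (\<lambda>n. S \<inter> X closure_of V n)" for C
        using that S(1) by auto
      show "C \<subseteq> D \<or> D \<subseteq> C" if CD: "C \<in> range (\<lambda>n. S \<inter> X closure_of V n)"
        "D \<in> range (\<lambda>n. S \<inter> X closure_of V n)" for C D
      proof -
        obtain m n where "C = S \<inter> X closure_of V m" "D = S \<inter> X closure_of V n" using CD by auto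
        then show ?thesis using decseqD[OF dec, of m n] decseqD[OF dec, of n m] nat_le_linear[of m n] by auto
      qed
      have "(\<Inter>n. X closure_of V n) \<subseteq> (\<Inter>n. V n)" using V(2) by blast
      then show "\<Inter>(range (\<lambda>n. S \<inter> X closure_of V n)) \<subseteq> U" using U(2) by auto
    qed
    then obtain n where n: "S \<inter> X closure_of V n \<subseteq> U" by auto
    \<comment> \<open>\<open>?O\<close> is an open set around \<open>S\<close> whose intersection
      with \<open>V n\<close> lies in \<open>U\<close>.\<close>
    let ?O = "U \<union> (topspace X - X closure_of V n)"
    have "openin X ?O" using U(1) by (intro openin_Un) auto
    moreover have "S \<subseteq> ?O" using n closedin_subset[OF S(1)] by auto
    ultimately obtain A where A: "A \<in> \<B>" "S \<subseteq> A" "A \<subseteq> ?O" using B(3)[of ?O] by auto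
    have AB: "A \<inter> V n \<in> ?B" using A(1) by (intro image_eqI[of _ _ "(A, n)"]) auto
    have "A \<inter> V n \<subseteq> U" using A(3) Vcl[of n] by auto
    moreover have "S \<inter> (\<Inter>n. V n) \<subseteq> A \<inter> V n" using A(2) by auto
    ultimately show ?thesis by (intro bexI[OF _ AB] conjI)
  qed
  moreover have "countable ?B" using B(1) by simp
  moreover have "\<forall>A\<in>?B. openin X A" using B(2) V(1) by auto
  ultimately show ?thesis
    unfolding countable_character_def by (intro exI[of _ ?B] conjI allI impI) blast+
qed

text \<open>The tube lemma, with the whole compact group as one factor, makes a single neighbourhood
  work for conjugation by all elements at once.\<close>

lemma (in topological_group) identity_nbhd_shrink:
  assumes cpt: "compact_space T" and V: "openin T V" "\<one> \<in> V"
  shows "\<exists>W. openin T W \<and> \<one> \<in> W \<and> (\<forall>x\<in>W. \<forall>y\<in>W. x \<otimes> inv y \<in> V) \<and>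
    (\<forall>g\<in>carrier G. \<forall>x\<in>W. g \<otimes> x \<otimes> inv g \<in> V) \<and> T closure_of W \<subseteq> V"
proof -
  have "continuous_map (prod_topology T T) T (\<lambda>z. fst z \<otimes> inv (snd z))"
    by (intro continuous_map_group)
  moreover have "\<one> \<otimes> inv \<one> \<in> V" using V by simp
  ultimately obtain A B where AB: "openin T A" "\<one> \<in> A" "openin T B" "\<one> \<in> B"
    "\<And>x y. x \<in> A \<Longrightarrow> y \<in> B \<Longrightarrow> x \<otimes> inv y \<in> V"
    by (rule continuous_map_nbhd2[where f = "\<lambda>x y. x \<otimes> inv y", OF _ V(1) _ one_closed one_closed]) auto
  let ?O = "{z \<in> topspace (prod_topology T T). fst z \<otimes> snd z \<otimes> inv (fst z) \<in> V}"
  have "continuous_map (prod_topology T T) T (\<lambda>z. fst z \<otimes> snd z \<otimes> inv (fst z))"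
    by (intro continuous_map_group)
  then have "openin (prod_topology T T) ?O"
    using V(1) by (rule openin_continuous_map_preimage)
  moreover have "compactin T (topspace T)" using cpt by (simp add: compact_space_def)
  moreover have "\<one> \<in> topspace T" by (simp add: topspace_eq)
  moreover have "topspace T \<times> {\<one>} \<subseteq> ?O" using V by (auto simp: topspace_eq)
  ultimately have "\<exists>D E. openin T D \<and> openin T E \<and> topspace T \<subseteq> D \<and> \<one> \<in> E \<and> D \<times> E \<subseteq> ?O"
    by (rule tube_lemma_left)
  then obtain D E where DE: "openin T E" "topspace T \<subseteq> D" "\<one> \<in> E" "D \<times> E \<subseteq> ?O" by auto
  let ?W = "A \<inter> B \<inter> E"
  have "T closure_of ?W \<subseteq> V"
  proof
    fix y assume y: "y \<in> T closure_of ?W"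
    then have yG: "y \<in> carrier G" using closure_of_subset_topspace topspace_eq by fast
    \<comment> \<open>\<open>?P\<close> is the translate of \<open>?W\<close> by \<open>y\<close>.
      It meets \<open>?W\<close> in some \<open>p\<close>, and then \<open>y\<close> is the product
      of \<open>p\<close> and the inverse of \<open>inv y \<otimes> p\<close>, both taken from
      \<open>?W\<close>.\<close>
    let ?P = "{p \<in> carrier G. inv y \<otimes> p \<in> ?W}"
    have "openin T ?P"
      by (rule openin_vimage) (use AB DE yG in \<open>auto intro!: continuous_map_group\<close>)
    moreover have "y \<in> ?P" using AB DE yG by simp
    ultimately have "y \<in> ?P \<and> openin T ?P" by (intro conjI)
    from y[unfolded in_closure_of, THEN conjunct2, THEN spec, THEN mp, OF this]
    obtain p where p: "p \<in> carrier G" "inv y \<otimes> p \<in> ?W" "p \<in> ?W" by auto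
    then have "p \<otimes> inv (inv y \<otimes> p) \<in> V" by (intro AB(5)) auto
    then show "y \<in> V" using p yG by (simp add: inv_mult_group mult_inv_cancel)
  qed
  moreover have "g \<otimes> x \<otimes> inv g \<in> V" if "g \<in> carrier G" "x \<in> ?W" for g x
  proof -
    have "(g, x) \<in> D \<times> E" using DE(2) that by (auto simp: topspace_eq)
    then have "(g, x) \<in> ?O" by (rule subsetD[OF DE(4)])
    then show ?thesis by simp
  qed
  ultimately show ?thesis
    using AB DE by (intro exI[of _ ?W]) auto
qed

text \<open>Iterate \<open>identity_nbhd_shrink\<close>: quotients and conjugates of elements of
  \<open>V (Suc n)\<close> lie in \<open>V n\<close>, so the intersection is a normal subgroup. The
  sequence itself is kept because \<open>countable_character_Int_decreasing\<close> works with
  it.\<close>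

lemma (in topological_group) normal_G_delta_in_nbhd:
  assumes cpt: "compact_space T" and U: "openin T U" "\<one> \<in> U"
  shows "\<exists>V :: nat \<Rightarrow> 'a set. (\<forall>n. openin T (V n) \<and> T closure_of V (Suc n) \<subseteq> V n) \<and>
    V 0 = U \<and> (\<Inter>n. V n) \<lhd> G"
proof -
  let ?Q = "\<lambda>V W. (\<forall>x\<in>W. \<forall>y\<in>W. x \<otimes> inv y \<in> V) \<and>
    (\<forall>g\<in>carrier G. \<forall>x\<in>W. g \<otimes> x \<otimes> inv g \<in> V) \<and> T closure_of W \<subseteq> V"
  \<comment> \<open>The implication for \<open>n = 0\<close> carries the starting set through the
    dependent choice.\<close>
  have "\<exists>V. \<forall>n. (openin T (V n) \<and> \<one> \<in> V n \<and> (n = 0 \<longrightarrow> V n = U)) \<and> ?Q (V n) (V (Suc n))"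
  proof (rule dependent_nat_choice)
    show "\<exists>V. openin T V \<and> \<one> \<in> V \<and> (0 = (0::nat) \<longrightarrow> V = U)" using U by auto
    fix V and n :: nat
    assume "openin T V \<and> \<one> \<in> V \<and> (n = 0 \<longrightarrow> V = U)"
    then show "\<exists>W. (openin T W \<and> \<one> \<in> W \<and> (Suc n = 0 \<longrightarrow> W = U)) \<and> ?Q V W"
      using identity_nbhd_shrink[OF cpt, of V] by auto
  qed
  then obtain V where VQ:
    "\<forall>n. (openin T (V n) \<and> \<one> \<in> V n \<and> (n = 0 \<longrightarrow> V n = U)) \<and> ?Q (V n) (V (Suc n))"
    by (rule exE)
  then have V: "\<And>n. openin T (V n)" "\<And>n. \<one> \<in> V n" "V 0 = U" by simp_all
  from VQ have Q: "?Q (V n) (V (Suc n))" for n by simp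
  let ?L = "\<Inter>n. V n"
  have div: "x \<otimes> inv y \<in> ?L" if "x \<in> ?L" "y \<in> ?L" for x y
  proof (rule INT_I)
    fix n
    have "x \<in> V (Suc n)" "y \<in> V (Suc n)" using that by auto
    then show "x \<otimes> inv y \<in> V n" using Q[of n] by simp
  qed
  have LG: "?L \<subseteq> carrier G" using openin_carrier[OF V(1)[of 0]] by auto
  have "\<one> \<in> ?L" using V(2) by auto
  have invL: "inv y \<in> ?L" if "y \<in> ?L" for y
  proof -
    have "\<one> \<otimes> inv y \<in> ?L" by (rule div[OF \<open>\<one> \<in> ?L\<close> that])
    then show ?thesis using that LG by auto
  qed
  have "subgroup ?L G"
  proof (rule subgroupI)
    show "x \<otimes> y \<in> ?L" if "x \<in> ?L" "y \<in> ?L" for x y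
    proof -
      have "x \<otimes> inv (inv y) \<in> ?L" by (rule div[OF that(1) invL[OF that(2)]])
      moreover have "y \<in> carrier G" using that LG by blast
      ultimately show ?thesis by (simp only: inv_inv)
    qed
  qed (use LG \<open>\<one> \<in> ?L\<close> invL in auto)
  moreover have "g \<otimes> x \<otimes> inv g \<in> ?L" if "g \<in> carrier G" "x \<in> ?L" for g x
  proof (rule INT_I)
    fix n
    have "x \<in> V (Suc n)" using that by auto
    then show "g \<otimes> x \<otimes> inv g \<in> V n" using Q[of n] that(1) by simp
  qed
  ultimately have "?L \<lhd> G" unfolding normal_inv_iff by (intro conjI ballI)
  then show ?thesis using V Q by (intro exI[of _ V]) auto
qed

text \<open>The open projection sends the countable family around \<open>N\<close> to a local base
  at the identity of the compact quotient.\<close>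

lemma (in topological_group) countable_character_imp_quotient_second_countable:
  assumes cpt: "compact_space T" and N: "N \<lhd> G" "closedin T N" and cc: "countable_character T N"
  shows "second_countable (coset_topology G T N)"
proof -
  interpret N: normal N G by (rule N(1))
  let ?p = "\<lambda>x. N #> x"
  interpret Q: topological_group "G Mod N" "coset_topology G T N"
    by (rule quotient_topological_group[OF N])
  have cont: "continuous_map T (coset_topology G T N) ?p"
    by (rule quotient_imp_continuous_map[OF quotient_map_quotient_topology])
  obtain \<B> where B: "countable \<B>" "\<And>A. A \<in> \<B> \<Longrightarrow> openin T A"
    "\<And>U. openin T U \<Longrightarrow> N \<subseteq> U \<Longrightarrow> \<exists>A\<in>\<B>. N \<subseteq> A \<and> A \<subseteq> U"
    using cc unfolding countable_character_def by auto
  show ?thesis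
  proof (rule Q.compact_second_countableI[of "(`) ?p ` \<B>"])
    show "compact_space (coset_topology G T N)"
      using image_compactin[OF _ cont, of "topspace T"] cpt by (simp add: compact_space_def)
    show "countable ((`) ?p ` \<B>)" using B(1) by simp
    show "openin (coset_topology G T N) V" if "V \<in> (`) ?p ` \<B>" for V
      using that openin_coset_image[OF N(1) B(2)] by auto
    fix U assume U: "openin (coset_topology G T N) U" "\<one>\<^bsub>G Mod N\<^esub> \<in> U"
    have "openin T {x \<in> topspace T. ?p x \<in> U}"
      using U(1) by (simp add: openin_quotient_topology)
    moreover have "N \<subseteq> {x \<in> topspace T. ?p x \<in> U}"
      using U(2) N.rcos_const[OF group_axioms] by (auto simp: topspace_eq)
    ultimately obtain A where A: "A \<in> \<B>" "N \<subseteq> A" "A \<subseteq> {x \<in> topspace T. ?p x \<in> U}"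
      using B(3)[of "{x \<in> topspace T. ?p x \<in> U}"] by auto
    have "N \<in> ?p ` A" using A(2) N.one_closed N.rcos_const[OF group_axioms] by (metis imageI subsetD)
    then show "\<exists>V\<in>(`) ?p ` \<B>. \<one>\<^bsub>G Mod N\<^esub> \<in> V \<and> V \<subseteq> U"
      using A by (intro bexI[of _ "?p ` A"]) auto
  qed
qed

subsection \<open>Dense sequences of cosets\<close>

text \<open>A sequence in the quotient by \<open>C 0\<close>, recorded as cosets so that a chain of such sequences can
  be intersected. Every open set is visited infinitely often, and not merely once, so that a
  refinement can assign the members of a countable base to distinct indices.\<close>

definition dense_coset_sequence ::
    "('a, 'm) monoid_scheme \<Rightarrow> 'a topology \<Rightarrow> (nat \<Rightarrow> 'a set) \<Rightarrow> bool"
  where "dense_coset_sequence G T C \<longleftrightarrow> C 0 \<lhd> G \<and> closedin T (C 0) \<and>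
    (\<forall>n. \<exists>x\<in>carrier G. C n = C 0 #>\<^bsub>G\<^esub> x) \<and>
    (\<forall>U. openin T U \<and> U \<noteq> {} \<longrightarrow> infinite {n. C n \<inter> U \<noteq> {}})"

text \<open>Strict growth keeps the chosen indices distinct. Positivity keeps index 0 free, where
  \<open>dense_coset_sequence\<close> stores the subgroup.\<close>

lemma infinite_sequence_choice:
  fixes A :: "nat \<Rightarrow> nat set"
  assumes "\<And>k. infinite (A k)"
  shows "\<exists>r. strict_mono r \<and> (\<forall>k. 0 < r k \<and> r k \<in> A k)"
proof -
  have "\<exists>r. \<forall>k. (0 < r k \<and> r k \<in> A k) \<and> r k < r (Suc k)"
  proof (rule dependent_nat_choice)
    show "\<exists>m. 0 < m \<and> m \<in> A 0"
      using assms[of 0] by (auto simp: infinite_nat_iff_unbounded)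
    show "\<exists>m'. (0 < m' \<and> m' \<in> A (Suc k)) \<and> m < m'" for m k
      using assms[of "Suc k"] by (metis infinite_nat_iff_unbounded less_nat_zero_code neq0_conv)
  qed
  then obtain r where "\<forall>k. (0 < r k \<and> r k \<in> A k) \<and> r k < r (Suc k)" by (rule exE)
  then show ?thesis by (intro exI[of _ r]) (simp add: strict_mono_Suc_iff)
qed

text \<open>Only the first coordinate of the decoded pair is used, so each value recurs along all
  second coordinates.\<close>

lemma countable_enumeration_infinitely_often:
  assumes "countable B" "B \<noteq> {}"
  shows "\<exists>b :: nat \<Rightarrow> 'b. range b \<subseteq> B \<and> (\<forall>v\<in>B. infinite {k. b k = v})"
proof -
  define b where "b k = from_nat_into B (fst (prod_decode k))" for k
  have "infinite {k. b k = v}" if v: "v \<in> B" for v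
  proof -
    obtain i where i: "from_nat_into B i = v" using from_nat_into_surj[OF assms(1) v] by auto
    have "infinite (range (\<lambda>j. prod_encode (i, j)))"
      by (rule range_inj_infinite) (auto intro!: injI)
    moreover have "range (\<lambda>j. prod_encode (i, j)) \<subseteq> {k. b k = v}" by (auto simp: b_def i)
    ultimately show ?thesis using infinite_super by auto
  qed
  moreover have "range b \<subseteq> B" using from_nat_into[OF assms(2)] by (auto simp: b_def)
  ultimately show ?thesis by (intro exI[of _ b]) auto
qed

text \<open>In each \<open>C m\<close> a representative \<open>y m\<close> is chosen. At the index
  \<open>r k\<close> it can be taken over the basic set \<open>b k\<close>, because
  \<open>C (r k)\<close> meets the preimage of \<open>b k\<close>. Each basic set recurs infinitely
  often in \<open>b\<close> and \<open>r\<close> is injective, so infinitely many of the new cosets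
  lie in it.\<close>

lemma (in topological_group) dense_coset_sequence_refine:
  assumes C: "dense_coset_sequence G T C" and N: "N \<lhd> G" "closedin T N" "N \<subseteq> C 0"
    and sc: "second_countable (coset_topology G T N)"
  shows "\<exists>C'. dense_coset_sequence G T C' \<and> C' 0 = N \<and> (\<forall>n. C' n \<subseteq> C n)"
proof -
  interpret N: normal N G by (rule N(1))
  interpret C0: normal "C 0" G using C by (simp add: dense_coset_sequence_def)
  let ?Q = "coset_topology G T N" and ?p = "\<lambda>x. N #> x"
  have Cx: "\<exists>x\<in>carrier G. C m = C 0 #> x" for m
    using C by (simp add: dense_coset_sequence_def)
  obtain B where B: "countable B" "\<And>V. V \<in> B \<Longrightarrow> openin ?Q V"
    "\<And>U x. openin ?Q U \<Longrightarrow> x \<in> U \<Longrightarrow> \<exists>V\<in>B. x \<in> V \<and> V \<subseteq> U"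
    using sc unfolding second_countable_def by auto
  \<comment> \<open>No coset can lie in the empty set, so it must not be enumerated.\<close>
  define B1 where "B1 = B - {{}}"
  have "?p \<one> \<in> topspace ?Q" by (simp add: topspace_eq)
  then have "B1 \<noteq> {}" using B(3)[OF openin_topspace, of "?p \<one>"] by (auto simp: B1_def)
  moreover have "countable B1" using B(1) by (simp add: B1_def)
  ultimately have "\<exists>b :: nat \<Rightarrow> 'a set set. range b \<subseteq> B1 \<and> (\<forall>v\<in>B1. infinite {k. b k = v})"
    by (intro countable_enumeration_infinitely_often)
  then obtain b :: "nat \<Rightarrow> 'a set set" where b: "range b \<subseteq> B1" "\<forall>v\<in>B1. infinite {k. b k = v}"
    by (elim exE conjE)
  define A where "A k = {n. C n \<inter> {x \<in> carrier G. ?p x \<in> b k} \<noteq> {}}" for k :: nat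
  have "infinite (A k)" for k
  proof -
    have bk: "b k \<in> B" "b k \<noteq> {}" using b(1) by (auto simp: B1_def)
    have "b k \<subseteq> ?p ` carrier G" "openin T {x \<in> carrier G. ?p x \<in> b k}"
      using B(2)[OF bk(1)] by (auto simp: openin_quotient_topology topspace_eq)
    moreover from this bk(2) have "{x \<in> carrier G. ?p x \<in> b k} \<noteq> {}" by auto
    ultimately show ?thesis using C unfolding A_def dense_coset_sequence_def by simp
  qed
  from infinite_sequence_choice[of A, OF this] obtain r where
    "strict_mono r \<and> (\<forall>k. 0 < r k \<and> r k \<in> A k)" by (rule exE)
  then have r: "strict_mono r" "\<And>k. 0 < r k" "\<And>k. r k \<in> A k" by simp_all
  have "\<exists>y. y \<in> C m \<and> (\<forall>k. m = r k \<longrightarrow> ?p y \<in> b k)" for m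
  proof (cases "m \<in> range r")
    case True
    then obtain k where k: "m = r k" by auto
    then obtain y where "y \<in> C m" "?p y \<in> b k" using r(3)[of k] by (auto simp: A_def)
    \<comment> \<open>Injectivity of \<open>r\<close> means that at most one basic set is prescribed
      at the index \<open>m\<close>.\<close>
    moreover have "k' = k" if "m = r k'" for k' using that k r(1) strict_mono_eq by metis
    ultimately show ?thesis by auto
  next
    case False
    obtain x where "x \<in> carrier G" "C m = C 0 #> x" using Cx[of m] by auto
    then have "x \<in> C m" using rcos_self[OF _ C0.subgroup_axioms] by simp
    then show ?thesis using False by auto
  qed
  then obtain y where "\<forall>m. y m \<in> C m \<and> (\<forall>k. m = r k \<longrightarrow> ?p (y m) \<in> b k)"
    by (rule choice[THEN exE, OF allI])
  then have y: "\<And>m. y m \<in> C m" "\<And>k. ?p (y (r k)) \<in> b k" by simp_all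
  have yG: "y m \<in> carrier G" for m
    using Cx[of m] y(1)[of m] C0.elemrcos_carrier[OF group_axioms] by auto
  have Cy: "C m = C 0 #> y m" for m
    using Cx[of m] y(1)[of m] repr_independence[OF _ _ C0.subgroup_axioms] by auto
  \<comment> \<open>Index 0 must hold \<open>N\<close> itself and not the coset of
    \<open>y 0\<close>. No prescribed visit is lost, since every \<open>r k\<close> is
    positive.\<close>
  define C' where "C' m = (if m = 0 then N else N #> y m)" for m
  have "dense_coset_sequence G T C'"
    unfolding dense_coset_sequence_def
  proof (intro conjI allI impI)
    show "C' 0 \<lhd> G" "closedin T (C' 0)" using N by (simp_all add: C'_def)
    show "\<exists>x\<in>carrier G. C' n = C' 0 #> x" for n
    proof (cases "n = 0")
      case True
      then show ?thesis using N.rcos_const[OF group_axioms N.one_closed]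
        by (intro bexI[of _ \<one>]) (auto simp: C'_def)
    next
      case False
      then show ?thesis using yG by (intro bexI[of _ "y n"]) (auto simp: C'_def)
    qed
    fix U assume U: "openin T U \<and> U \<noteq> {}"
    then obtain u where u: "u \<in> U" by auto
    have UG: "U \<subseteq> carrier G" using U openin_carrier by auto
    have "openin ?Q (?p ` U)" using U openin_coset_image[OF N(1)] by simp
    then obtain v where v: "v \<in> B" "?p u \<in> v" "v \<subseteq> ?p ` U" using B(3)[of "?p ` U" "?p u"] u by auto
    then have "v \<in> B1" by (auto simp: B1_def)
    with b(2) have "infinite {k. b k = v}" by (rule bspec)
    then have "infinite (r ` {k. b k = v})"
      using strict_mono_imp_inj_on[OF r(1)] finite_imageD inj_on_subset by blast
    moreover have "r ` {k. b k = v} \<subseteq> {n. C' n \<inter> U \<noteq> {}}"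
    proof (intro image_subsetI CollectI)
      fix k assume "k \<in> {k. b k = v}"
      then have "?p (y (r k)) \<in> ?p ` U" using y(2)[of k] v(3) by auto
      then obtain z where z: "z \<in> U" "?p (y (r k)) = ?p z" by auto
      then have "z \<in> ?p (y (r k))" using rcos_self[OF _ N.subgroup_axioms] UG by auto
      then show "C' (r k) \<inter> U \<noteq> {}" using z(1) r(2)[of k] by (auto simp: C'_def)
    qed
    ultimately show "infinite {n. C' n \<inter> U \<noteq> {}}" using infinite_super by auto
  qed
  moreover have "C' n \<subseteq> C n" for n
    using N(3) Cy[of n] by (auto simp: C'_def r_coset_def)
  ultimately show ?thesis by (intro exI[of _ C']) (auto simp: C'_def)
qed

text \<open>A point \<open>z\<close> of the intersection at \<open>n\<close> lies in every
  \<open>c n\<close>, so each of these is \<open>c 0 #> z\<close> and the intersection is again a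
  coset of \<open>D 0\<close>. Density holds because visits of a suitable member of the chain to a
  smaller open set force visits of \<open>D\<close> to the given one.\<close>

lemma (in topological_group) dense_coset_sequence_Inter:
  assumes cpt: "compact_space T" and ne: "\<C> \<noteq> {}"
    and dcs: "\<And>c. c \<in> \<C> \<Longrightarrow> dense_coset_sequence G T c"
    and chain: "\<And>c d. c \<in> \<C> \<Longrightarrow> d \<in> \<C> \<Longrightarrow> (\<forall>n. c n \<subseteq> d n) \<or> (\<forall>n. d n \<subseteq> c n)"
  shows "dense_coset_sequence G T (\<lambda>n. \<Inter>c\<in>\<C>. c n)"
proof -
  define D where "D n = (\<Inter>c\<in>\<C>. c n)" for n
  have norm: "c 0 \<lhd> G" and cl0: "closedin T (c 0)" and Cx: "\<exists>x\<in>carrier G. c n = c 0 #> x"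
    and inf: "openin T U \<Longrightarrow> U \<noteq> {} \<Longrightarrow> infinite {n. c n \<inter> U \<noteq> {}}"
    if "c \<in> \<C>" for c n U
    using dcs[OF that] by (simp_all add: dense_coset_sequence_def)
  have sub: "subgroup (c 0) G" if "c \<in> \<C>" for c
    using norm[OF that] by (rule normal_imp_subgroup)
  have cz: "c n = c 0 #> z" "z \<in> carrier G" if c: "c \<in> \<C>" and z: "z \<in> c n" for c n z
  proof -
    obtain x where x: "x \<in> carrier G" "c n = c 0 #> x" using Cx[OF c, of n] by auto
    then have zx: "z \<in> c 0 #> x" using z by simp
    show "z \<in> carrier G" by (rule subgroup.elemrcos_carrier[OF sub[OF c] group_axioms x(1) zx])
    show "c n = c 0 #> z" using repr_independence[OF zx x(1) sub[OF c]] x(2) by simp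
  qed
  have cl: "closedin T (c n)" if c: "c \<in> \<C>" for c n
  proof -
    obtain x where x: "x \<in> carrier G" "c n = c 0 #> x" using Cx[OF c, of n] by auto
    have "closedin T {z \<in> topspace T. z \<otimes> inv x \<in> c 0}"
      by (rule closedin_continuous_map_preimage[OF _ cl0[OF c]])
        (use x in \<open>auto intro!: continuous_map_group\<close>)
    also have "{z \<in> topspace T. z \<otimes> inv x \<in> c 0} = c n"
      using x subgroup.rcos_module[OF sub[OF c] group_axioms x(1)]
        subgroup.elemrcos_carrier[OF sub[OF c] group_axioms x(1)]
      by (auto simp: topspace_eq)
    finally show ?thesis .
  qed
  have cne: "c n \<noteq> {}" if c: "c \<in> \<C>" for c n
    using Cx[OF c, of n] rcos_self[OF _ sub[OF c]] by auto
  have small: "\<exists>c\<in>\<C>. c n \<subseteq> U" if U: "openin T U" "D n \<subseteq> U" for n U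
  proof -
    have "\<exists>C\<in>(\<lambda>c. c n) ` \<C>. C \<subseteq> U"
    proof (rule compact_space_chain_subset_open[OF cpt _ _ _ U(1)])
      show "(\<lambda>c. c n) ` \<C> \<noteq> {}" using ne by simp
      show "closedin T C" if "C \<in> (\<lambda>c. c n) ` \<C>" for C using that cl by auto
      show "C \<subseteq> E \<or> E \<subseteq> C" if "C \<in> (\<lambda>c. c n) ` \<C>" "E \<in> (\<lambda>c. c n) ` \<C>" for C E
        using that chain by auto
      show "\<Inter>((\<lambda>c. c n) ` \<C>) \<subseteq> U" using U(2) by (simp add: D_def)
    qed
    then show ?thesis by auto
  qed
  \<comment> \<open>If \<open>D n\<close> were empty, \<open>small\<close> with the empty set as
    \<open>U\<close> would make some \<open>c n\<close> empty.\<close>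
  have Dne: "D n \<noteq> {}" for n
  proof
    assume "D n = {}"
    then have "\<exists>c\<in>\<C>. c n \<subseteq> {}" by (intro small) auto
    then show False using cne by auto
  qed
  have D0: "D 0 \<lhd> G"
  proof -
    have "subgroup (\<Inter>((\<lambda>c. c 0) ` \<C>)) G"
      by (rule subgroups_Inter) (use ne sub in auto)
    moreover have "x \<otimes> h \<otimes> inv x \<in> c 0" if "c \<in> \<C>" "x \<in> carrier G" "h \<in> c 0" for c x h
      by (rule normal.inv_op_closed2[OF norm[OF that(1)] that(2,3)])
    ultimately show ?thesis unfolding normal_inv_iff D_def by auto
  qed
  then interpret D0: normal "D 0" G .
  have clD: "closedin T (D n)" for n
    unfolding D_def by (rule closedin_INT[OF ne]) (use cl in auto)
  have Dz: "D n = D 0 #> z" "z \<in> carrier G" if z: "z \<in> D n" for n z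
  proof -
    have zc: "z \<in> c n" if "c \<in> \<C>" for c using z that by (simp add: D_def)
    show zG: "z \<in> carrier G" using ne zc cz(2) by auto
    have "w \<in> D n \<longleftrightarrow> w \<in> D 0 #> z" if w: "w \<in> carrier G" for w
    proof -
      have "w \<in> c n \<longleftrightarrow> w \<otimes> inv z \<in> c 0" if c: "c \<in> \<C>" for c
        using cz(1)[OF c zc[OF c]] subgroup.rcos_module[OF sub[OF c] group_axioms zG w] by simp
      then show ?thesis
        using D0.rcos_module[OF group_axioms zG w] by (auto simp: D_def)
    qed
    moreover have "D n \<subseteq> carrier G" using closedin_subset[OF clD] by (simp add: topspace_eq)
    moreover have "D 0 #> z \<subseteq> carrier G" using r_coset_subset_G[OF D0.subset zG] .
    ultimately show "D n = D 0 #> z" by blast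
  qed
  have "infinite {n. D n \<inter> U \<noteq> {}}" if U: "openin T U" "U \<noteq> {}" for U
  proof -
    obtain u where u: "u \<in> U" using U(2) by auto
    have UG: "U \<subseteq> carrier G" using openin_carrier[OF U(1)] .
    \<comment> \<open>An open set containing \<open>u\<close> need not be saturated for any member of the chain; \<open>D 0 \<cdot> U\<close>
      contains one that is.\<close>
    define M where "M = (\<Union>m\<in>D 0. {z \<in> carrier G. m \<otimes> z \<in> U})"
    have Mop: "openin T M"
      unfolding M_def
      by (intro openin_Union ballI) (auto intro!: openin_vimage[OF _ U(1)] continuous_map_group)
    have Mu: "m \<otimes> u \<in> M" if m: "m \<in> D 0" for m
    proof -
      have "inv m \<otimes> (m \<otimes> u) \<in> U" using u UG m by (auto simp: mult_inv_cancel)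
      moreover have "m \<otimes> u \<in> carrier G" using u UG m by auto
      ultimately show ?thesis unfolding M_def using m by (intro UN_I[of "inv m"]) auto
    qed
    let ?O = "{z \<in> topspace (prod_topology T T). fst z \<otimes> snd z \<in> M}"
    have "continuous_map (prod_topology T T) T (\<lambda>z. fst z \<otimes> snd z)"
      by (intro continuous_map_group)
    then have "openin (prod_topology T T) ?O" using Mop by (rule openin_continuous_map_preimage)
    moreover have "compactin T (D 0)" using cpt clD by (rule closedin_compact_space)
    moreover have "u \<in> topspace T" using u UG by (auto simp: topspace_eq)
    moreover have "D 0 \<times> {u} \<subseteq> ?O" using Mu u UG by (auto simp: topspace_eq)
    ultimately have "\<exists>A V. openin T A \<and> openin T V \<and> D 0 \<subseteq> A \<and> u \<in> V \<and> A \<times> V \<subseteq> ?O"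
      by (rule tube_lemma_left)
    then obtain A V where AV: "openin T A" "openin T V" "D 0 \<subseteq> A" "u \<in> V" "A \<times> V \<subseteq> ?O" by auto
    obtain c where c: "c \<in> \<C>" "c 0 \<subseteq> A" using small[OF AV(1,3)] by auto
    \<comment> \<open>If \<open>c n\<close> meets \<open>V\<close> in \<open>v\<close>, every
      \<open>z\<close> in \<open>D n\<close> lies in \<open>c 0 #> v\<close> and hence in
      \<open>M\<close>. Left multiplication by an element of \<open>D 0\<close> then moves
      \<open>z\<close> into \<open>U\<close> without leaving \<open>D n\<close>.\<close>
    have "{n. c n \<inter> V \<noteq> {}} \<subseteq> {n. D n \<inter> U \<noteq> {}}"
    proof (intro subsetI CollectI)
      fix n assume "n \<in> {n. c n \<inter> V \<noteq> {}}"
      then obtain v where v: "v \<in> c n" "v \<in> V" by auto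
      obtain z where z: "z \<in> D n" using Dne[of n] by auto
      then have "z \<in> c 0 #> v" using cz(1)[OF c(1) v(1)] c(1) by (auto simp: D_def)
      then obtain h where h: "h \<in> c 0" "z = h \<otimes> v" by (auto simp: r_coset_def)
      then have "(h, v) \<in> ?O" using c(2) v(2) by (intro subsetD[OF AV(5)]) auto
      then have "z \<in> M" using h(2) by simp
      then obtain m where m: "m \<in> D 0" "m \<otimes> z \<in> U" by (auto simp: M_def)
      then have "m \<otimes> z \<in> D 0 #> z" by (auto simp: r_coset_def)
      then show "D n \<inter> U \<noteq> {}" using m(2) Dz(1)[OF z] by auto
    qed
    moreover have "infinite {n. c n \<inter> V \<noteq> {}}" by (rule inf[OF c(1) AV(2)]) (use AV(4) in auto)
    ultimately show ?thesis using infinite_super by auto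
  qed
  moreover have "\<exists>x\<in>carrier G. D n = D 0 #> x" for n
    using Dne[of n] Dz[of _ n] by auto
  ultimately show ?thesis
    using D0 clD[of 0] unfolding dense_coset_sequence_def D_def by auto
qed

lemma (in topological_group) minimal_dense_coset_sequence:
  assumes cpt: "compact_space T"
  shows "\<exists>C. dense_coset_sequence G T C \<and>
    (\<forall>C'. dense_coset_sequence G T C' \<and> (\<forall>n. C' n \<subseteq> C n) \<longrightarrow> C' = C)"
proof -
  let ?A = "{C. dense_coset_sequence G T C}"
  \<comment> \<open>The order is reverse inclusion at every index, so a maximal element for Zorn's
    lemma is a minimal sequence.\<close>
  let ?P = "\<lambda>C C'. \<forall>n :: nat. C' n \<subseteq> (C n :: 'a set)"
  have "\<exists>m\<in>?A. \<forall>a\<in>?A. ?P m a \<longrightarrow> a = m"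
  proof (rule predicate_Zorn)
    show "partial_order_on ?A (relation_of ?P ?A)"
      by (rule partial_order_on_relation_ofI) (auto intro!: ext)
    fix \<C> assume ch: "\<C> \<in> Chains (relation_of ?P ?A)"
    show "\<exists>u\<in>?A. \<forall>a\<in>\<C>. ?P a u"
    proof (cases "\<C> = {}")
      case True
      \<comment> \<open>The empty chain is bounded by the constant sequence at the only point of the
        trivial quotient.\<close>
      have "dense_coset_sequence G T (\<lambda>n. carrier G)"
        unfolding dense_coset_sequence_def
      proof (intro conjI allI impI)
        show "carrier G \<lhd> G" by (rule normal_self)
        show "closedin T (carrier G)" using closedin_topspace[of T] by (simp add: topspace_eq)
        show "\<exists>x\<in>carrier G. carrier G = carrier G #> x" for n :: nat
          by (intro bexI[of _ \<one>]) simp_all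
        fix U assume U: "openin T U \<and> U \<noteq> {}"
        then have "{n :: nat. carrier G \<inter> U \<noteq> {}} = UNIV" using openin_carrier[of U] by auto
        then show "infinite {n :: nat. carrier G \<inter> U \<noteq> {}}" by simp
      qed
      then show ?thesis using True by auto
    next
      case False
      have "dense_coset_sequence G T (\<lambda>n. \<Inter>c\<in>\<C>. c n)"
        by (rule dense_coset_sequence_Inter[OF cpt False])
          (use ch in \<open>auto simp: Chains_def relation_of_def\<close>)
      then show ?thesis by (intro bexI[of _ "\<lambda>n. \<Inter>c\<in>\<C>. c n"]) auto
    qed
  qed
  then show ?thesis by auto
qed

subsection \<open>Countable dense subgroups of quotients\<close>

text \<open>\<open>S n\<close> collects the products obtained in \<open>n\<close> rounds from the
  identity, the generators and their inverses. The stages increase, so their countable union is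
  closed under products.\<close>

lemma countable_generate:
  assumes "countable A"
  shows "countable (generate G A)"
proof -
  define S where "S = rec_nat ({\<one>\<^bsub>G\<^esub>} \<union> A \<union> (\<lambda>x. inv\<^bsub>G\<^esub> x) ` A)
    (\<lambda>_ X. X \<union> (\<lambda>(x, y). x \<otimes>\<^bsub>G\<^esub> y) ` (X \<times> X))"
  have S: "S 0 = {\<one>\<^bsub>G\<^esub>} \<union> A \<union> (\<lambda>x. inv\<^bsub>G\<^esub> x) ` A"
    "S (Suc n) = S n \<union> (\<lambda>(x, y). x \<otimes>\<^bsub>G\<^esub> y) ` (S n \<times> S n)" for n
    by (simp_all add: S_def)
  have "countable (S n)" for n
    by (induction n) (use assms in \<open>simp_all add: S\<close>)
  then have "countable (\<Union>n. S n)" by simp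
  have "incseq S" by (rule incseq_SucI) (simp add: S)
  have "x \<in> (\<Union>n. S n)" if "x \<in> generate G A" for x
    using that
  proof (induction rule: generate.induct)
    case (eng x y)
    then obtain m n where "x \<in> S m" "y \<in> S n" by auto
    then have "x \<in> S (max m n)" "y \<in> S (max m n)"
      using incseqD[OF \<open>incseq S\<close>, of m "max m n"] incseqD[OF \<open>incseq S\<close>, of n "max m n"] by auto
    then have "x \<otimes>\<^bsub>G\<^esub> y \<in> S (Suc (max m n))" by (auto simp: S)
    then show ?case by auto
  qed (use S(1) in auto)
  then have "generate G A \<subseteq> (\<Union>n. S n)" by (rule subsetI)
  then show ?thesis using \<open>countable (\<Union>n. S n)\<close> by (rule countable_subset)
qed

text \<open>The cosets generate a countable dense subgroup \<open>D\<close> of the quotient, and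
  \<open>D\<close> is the image of its preimage \<open>H\<close>, a dense subgroup of
  \<open>G\<close>. The hypothesis thus makes \<open>D\<close> second countable. Regularity extends
  a countable base of \<open>D\<close> to the quotient near the identity, and preimages under the
  projection finish the argument.\<close>

lemma (in topological_group) dense_coset_sequence_countable_character:
  assumes cpt: "compact_space T" and C: "dense_coset_sequence G T C"
    and arh: "\<And>H. subgroup H G \<Longrightarrow> T closure_of H = topspace T \<Longrightarrow>
      projectively_arhangelskii (G\<lparr>carrier := H\<rparr>) (subtopology T H)"
  shows "countable_character T (C 0)"
proof -
  define N where "N = C 0"
  have N: "N \<lhd> G" "closedin T N" and Cx: "\<exists>x\<in>carrier G. C n = N #> x"
    and inf: "openin T U \<and> U \<noteq> {} \<longrightarrow> infinite {n. C n \<inter> U \<noteq> {}}" for n U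
    using C by (simp_all add: dense_coset_sequence_def N_def)
  interpret N: normal N G by (rule N(1))
  let ?Q = "coset_topology G T N" and ?p = "\<lambda>x. N #> x"
  interpret Q: topological_group "G Mod N" ?Q by (rule quotient_topological_group[OF N])
  have cont: "continuous_map T ?Q ?p"
    by (rule quotient_imp_continuous_map[OF quotient_map_quotient_topology])
  have cptQ: "compact_space ?Q"
    using image_compactin[OF _ cont, of "topspace T"] cpt by (simp add: compact_space_def)
  have pn: "?p n = N" if "n \<in> N" for n using N.rcos_const[OF group_axioms that] .
  define D where "D = generate (G Mod N) (range C)"
  have rC: "range C \<subseteq> carrier (G Mod N)" using Cx by (auto simp: carrier_FactGroup)
  have D: "subgroup D (G Mod N)" unfolding D_def by (rule Q.generate_is_subgroup[OF rC])
  have CD: "C n \<in> D" for n unfolding D_def by (intro generate.incl) simp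
  have DQ: "D \<subseteq> carrier (G Mod N)" by (rule subgroup.subset[OF D])
  \<comment> \<open>Used twice: for density of \<open>H\<close> in the group and for density of
    \<open>D\<close> in the quotient.\<close>
  have meet: "\<exists>z\<in>U. ?p z \<in> D" if U: "openin T U" "U \<noteq> {}" for U
  proof -
    have "{n. C n \<inter> U \<noteq> {}} \<noteq> {}" using inf[of U] U by (metis finite.emptyI)
    then obtain n z where z: "z \<in> C n" "z \<in> U" by auto
    obtain x where x: "x \<in> carrier G" "C n = N #> x" using Cx[of n] by auto
    then have "?p x = ?p z" using z(1) by (intro repr_independence[OF _ x(1) N.subgroup_axioms]) simp
    then show ?thesis using z x CD[of n] by (intro bexI[of _ z]) simp_all
  qed
  define H where "H = {x \<in> carrier G. ?p x \<in> D}"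
  have H: "subgroup H G"
  proof (rule subgroupI)
    have "?p \<one> \<in> D" using pn[OF N.one_closed] subgroup.one_closed[OF D] by simp
    then show "H \<noteq> {}" by (auto simp: H_def)
    fix a b assume a: "a \<in> H" and b: "b \<in> H"
    have "inv\<^bsub>G Mod N\<^esub> (?p a) = ?p (inv a)"
      using a by (simp add: N.inv_FactGroup carrier_FactGroup N.rcos_inv H_def)
    then show "inv a \<in> H" using a subgroup.m_inv_closed[OF D, of "?p a"] by (simp add: H_def)
    show "a \<otimes> b \<in> H"
      using a b subgroup.m_closed[OF D, of "?p a" "?p b"] by (simp add: H_def N.rcos_sum)
  qed (auto simp: H_def)
  have "T closure_of H = topspace T"
    unfolding dense_intersects_open
  proof (intro allI impI)
    fix U assume U: "openin T U \<and> U \<noteq> {}"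
    then obtain z where "z \<in> U" "?p z \<in> D" using meet[of U] by auto
    then show "H \<inter> U \<noteq> {}" using U openin_carrier[of U] by (auto simp: H_def)
  qed
  with H have pa: "projectively_arhangelskii (G\<lparr>carrier := H\<rparr>) (subtopology T H)" by (rule arh)
  \<comment> \<open>Cosets are sets of elements of \<open>G\<close>, so \<open>K\<close> has the
    type over which \<open>projectively_arhangelskii\<close> quantifies.\<close>
  define K where "K = (G Mod N)\<lparr>carrier := D\<rparr>"
  define S where "S = subtopology ?Q D"
  have "topological_group K S"
    unfolding K_def S_def by (rule Q.subgroup_topological_group[OF D])
  moreover have "?p ` H = D" using DQ by (auto simp: H_def carrier_FactGroup)
  then have "?p \<in> epi (G\<lparr>carrier := H\<rparr>) K"
    by (auto simp: epi_def hom_def K_def H_def N.rcos_sum)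
  moreover have "continuous_map (subtopology T H) S ?p"
    unfolding S_def continuous_map_in_subtopology
    using continuous_map_from_subtopology[OF cont] by (auto simp: H_def)
  ultimately have "arhangelskii S"
    using pa unfolding projectively_arhangelskii_def by blast
  moreover have "countable (topspace S)"
    unfolding S_def by (auto simp: D_def intro!: countable_Int2 countable_generate)
  ultimately have "second_countable S" by (rule countable_arhangelskii_imp_second_countable)
  then obtain B where B: "countable B" "\<And>V. V \<in> B \<Longrightarrow> openin S V"
    "\<And>U x. openin S U \<Longrightarrow> x \<in> U \<Longrightarrow> \<exists>V\<in>B. x \<in> V \<and> V \<subseteq> U"
    unfolding second_countable_def by auto
  have "\<forall>b\<in>B. \<exists>V. openin ?Q V \<and> b = V \<inter> D"
    using B(2) unfolding S_def openin_subtopology by auto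
  then obtain v where "\<forall>b\<in>B. openin ?Q (v b) \<and> b = v b \<inter> D"
    by (rule bchoice[THEN exE])
  then have v: "openin ?Q (v b)" "b = v b \<inter> D" if "b \<in> B" for b using that by auto
  define O' where "O' b = {x \<in> topspace T. ?p x \<in> v b}" for b
  have "\<exists>V\<in>O' ` B. N \<subseteq> V \<and> V \<subseteq> U" if U: "openin T U" "N \<subseteq> U" for U
  proof -
    \<comment> \<open>\<open>M\<close> consists of the cosets contained in \<open>U\<close>. It is
      open because the projection from a compact space to a Hausdorff space is closed.\<close>
    define M where "M = topspace ?Q - ?p ` (topspace T - U)"
    have "closedin T (topspace T - U)" by (rule closedin_diff[OF closedin_topspace U(1)])
    then have "closedin ?Q (?p ` (topspace T - U))"
      using continuous_imp_closed_map[OF cont cpt Q.Hausdorff] unfolding closed_map_def by simp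
    then have "openin ?Q M" unfolding M_def by (rule openin_diff[OF openin_topspace])
    moreover have "\<one>\<^bsub>G Mod N\<^esub> \<in> M"
    proof -
      have "?p x \<noteq> N" if x: "x \<in> topspace T - U" for x
      proof
        assume "?p x = N"
        moreover have "x \<in> ?p x" using x rcos_self[OF _ N.subgroup_axioms] by (simp add: topspace_eq)
        ultimately show False using x U(2) by auto
      qed
      moreover have "N \<in> topspace ?Q" using Q.one_closed Q.topspace_eq by simp
      ultimately show ?thesis by (auto simp: M_def)
    qed
    ultimately obtain W where W: "openin ?Q W" "\<one>\<^bsub>G Mod N\<^esub> \<in> W" "?Q closure_of W \<subseteq> M"
      using Q.identity_nbhd_shrink[OF cptQ] by metis
    have ND: "N \<in> D" using subgroup.one_closed[OF D] by simp
    have "openin S (W \<inter> D)" unfolding S_def by (rule openin_subtopology_Int[OF W(1)])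
    moreover have "N \<in> W \<inter> D" using W(2) ND by simp
    ultimately obtain b where b: "b \<in> B" "N \<in> b" "b \<subseteq> W \<inter> D" using B(3)[of "W \<inter> D" N] by auto
    \<comment> \<open>As \<open>D\<close> is dense, an open set lies in the closure of its trace on
      \<open>D\<close>. This controls all of \<open>v b\<close>, although only
      \<open>v b \<inter> D\<close> is known to lie in \<open>W\<close>.\<close>
    have "v b \<subseteq> ?Q closure_of (v b \<inter> D)"
    proof -
      have "?Q closure_of D = topspace ?Q"
        unfolding dense_intersects_open
      proof (intro allI impI)
        fix V assume V: "openin ?Q V \<and> V \<noteq> {}"
        then have "openin T {x \<in> topspace T. ?p x \<in> V}" "V \<subseteq> ?p ` topspace T"
          by (simp_all add: openin_quotient_topology)
        moreover from this V have "{x \<in> topspace T. ?p x \<in> V} \<noteq> {}" by auto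
        ultimately obtain z where "z \<in> {x \<in> topspace T. ?p x \<in> V}" "?p z \<in> D"
          using meet[of "{x \<in> topspace T. ?p x \<in> V}"] by auto
        then show "D \<inter> V \<noteq> {}" by auto
      qed
      then show ?thesis
        using openin_Int_closure_of_subset[OF v(1)[OF b(1)], of D] openin_subset[OF v(1)[OF b(1)]]
        by (simp add: Int_absorb2)
    qed
    also have "\<dots> \<subseteq> ?Q closure_of W"
      by (rule closure_of_mono) (use b(3) v(2)[OF b(1)] in auto)
    also have "\<dots> \<subseteq> M" by (rule W(3))
    finally have "O' b \<subseteq> U" by (auto simp: O'_def M_def)
    moreover have "N \<subseteq> O' b"
    proof
      fix n assume n: "n \<in> N"
      have "N \<in> v b" using b(2) v(2)[OF b(1)] by auto
      then show "n \<in> O' b" using n pn[OF n] by (simp add: O'_def topspace_eq)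
    qed
    ultimately show ?thesis using b(1) by auto
  qed
  moreover have "countable (O' ` B)" using B(1) by simp
  moreover have "\<forall>V\<in>O' ` B. openin T V"
    using v(1) by (auto simp: O'_def openin_quotient_topology)
  ultimately show ?thesis
    unfolding countable_character_def N_def[symmetric]
    by (intro exI[of _ "O' ` B"] conjI allI impI) simp_all
qed

section \<open>Metrizability and dense subgroups\<close>

theorem theorem4p2:
  fixes G :: "('a, 'm) monoid_scheme" and T :: "'a topology"
  assumes "topological_group G T" and "compact_space T"
  shows "(\<forall>H. subgroup H G \<and> T closure_of H = topspace T \<longrightarrow>
            projectively_arhangelskii (G\<lparr>carrier := H\<rparr>) (subtopology T H))
         \<longleftrightarrow> metrizable_space T"
proof
  interpret topological_group G T by (rule assms(1))
  note cpt = assms(2)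
  assume arh: "\<forall>H. subgroup H G \<and> T closure_of H = topspace T \<longrightarrow>
    projectively_arhangelskii (G\<lparr>carrier := H\<rparr>) (subtopology T H)"
  obtain C where C: "dense_coset_sequence G T C"
    and min: "\<forall>C'. dense_coset_sequence G T C' \<and> (\<forall>n. C' n \<subseteq> C n) \<longrightarrow> C' = C"
    using minimal_dense_coset_sequence[OF cpt] by auto
  have N: "C 0 \<lhd> G" "closedin T (C 0)" using C by (simp_all add: dense_coset_sequence_def)
  have cc: "countable_character T (C 0)"
    by (rule dense_coset_sequence_countable_character[OF cpt C]) (use arh in simp)
  have "C 0 \<subseteq> {\<one>\<^bsub>G\<^esub>}"
  proof
    fix a assume a: "a \<in> C 0"
    show "a \<in> {\<one>\<^bsub>G\<^esub>}"
    proof (rule ccontr)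
      assume "a \<notin> {\<one>\<^bsub>G\<^esub>}"
      \<comment> \<open>Removing \<open>a\<close> from the first neighbourhood ensures that the
        normal subgroup found inside it omits \<open>a\<close>.\<close>
      have "openin T (topspace T - {a})"
        using Hausdorff_imp_t1_space[OF Hausdorff] by (simp add: t1_space_openin_delete_alt)
      moreover have "\<one>\<^bsub>G\<^esub> \<in> topspace T - {a}" using \<open>a \<notin> {\<one>\<^bsub>G\<^esub>}\<close> by (simp add: topspace_eq)
      ultimately have "\<exists>V :: nat \<Rightarrow> 'a set. (\<forall>n. openin T (V n) \<and> T closure_of V (Suc n) \<subseteq> V n) \<and>
          V 0 = topspace T - {a} \<and> (\<Inter>n. V n) \<lhd> G"
        by (rule normal_G_delta_in_nbhd[OF cpt])
      then obtain V :: "nat \<Rightarrow> 'a set" where V: "\<forall>n. openin T (V n) \<and> T closure_of V (Suc n) \<subseteq> V n"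
        "V 0 = topspace T - {a}" "(\<Inter>n. V n) \<lhd> G" by (elim exE conjE)
      have "V n \<subseteq> T closure_of V n" for n using V(1) by (simp add: closure_of_subset openin_subset)
      then have "(\<Inter>n. V n) = (\<Inter>n. T closure_of V n)" using V(1) by blast
      then have clV: "closedin T (\<Inter>n. V n)" by auto
      \<comment> \<open>\<open>?N\<close> is smaller than \<open>C 0\<close>, since it omits
        \<open>a\<close>, and still has countable character. A refinement of \<open>C\<close> over
        it therefore contradicts minimality.\<close>
      let ?N = "C 0 \<inter> (\<Inter>n. V n)"
      have N': "?N \<lhd> G" by (rule normal_subgroup_intersect[OF N(1) V(3)])
      have cl': "closedin T ?N" by (rule closedin_Int[OF N(2) clV])
      have "countable_character T ?N"
        by (rule countable_character_Int_decreasing[OF cpt N(2) cc]) (use V(1) in auto)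
      then have "second_countable (coset_topology G T ?N)"
        by (rule countable_character_imp_quotient_second_countable[OF cpt N' cl'])
      then obtain C' where "dense_coset_sequence G T C'" "C' 0 = ?N" "\<forall>n. C' n \<subseteq> C n"
        using dense_coset_sequence_refine[OF C N' cl' Int_lower1] by auto
      then have "C 0 = ?N" using min by metis
      then have "a \<in> V 0" using a by auto
      then show False using V(2) by simp
    qed
  qed
  then have "C 0 = {\<one>\<^bsub>G\<^esub>}" using subgroup.one_closed[OF normal_imp_subgroup[OF N(1)]] by auto
  \<comment> \<open>For the trivial subgroup, countable character is a countable local base at the
    identity.\<close>
  then obtain B where B: "countable B" "\<And>V. V \<in> B \<Longrightarrow> openin T V"
    "\<And>U. openin T U \<Longrightarrow> \<one>\<^bsub>G\<^esub> \<in> U \<Longrightarrow> \<exists>V\<in>B. \<one>\<^bsub>G\<^esub> \<in> V \<and> V \<subseteq> U"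
    using cc unfolding countable_character_def by auto
  have "second_countable T" by (rule compact_second_countableI[OF cpt B])
  then show "metrizable_space T"
    by (rule compact_Hausdorff_second_countable_imp_metrizable[OF cpt Hausdorff])
next
  interpret topological_group G T by (rule assms(1))
  note cpt = assms(2)
  assume "metrizable_space T"
  \<comment> \<open>Only the countable local base at the identity is taken from the metric; finitely
    many translates of each member supply the rest.\<close>
  then have "first_countable T" by (rule metrizable_imp_first_countable)
  then have "\<exists>B. countable B \<and> (\<forall>V\<in>B. openin T V) \<and>
      (\<forall>U. openin T U \<and> \<one>\<^bsub>G\<^esub> \<in> U \<longrightarrow> (\<exists>V\<in>B. \<one>\<^bsub>G\<^esub> \<in> V \<and> V \<subseteq> U))"
    unfolding first_countable_def by (simp add: topspace_eq)
  then obtain B where B: "countable B" "\<And>V. V \<in> B \<Longrightarrow> openin T V"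
    "\<And>U. openin T U \<Longrightarrow> \<one>\<^bsub>G\<^esub> \<in> U \<Longrightarrow> \<exists>V\<in>B. \<one>\<^bsub>G\<^esub> \<in> V \<and> V \<subseteq> U"
    by auto
  have sc: "second_countable T" by (rule compact_second_countableI[OF cpt B])
  show "\<forall>H. subgroup H G \<and> T closure_of H = topspace T \<longrightarrow>
    projectively_arhangelskii (G\<lparr>carrier := H\<rparr>) (subtopology T H)"
    unfolding projectively_arhangelskii_def
  proof (intro allI impI, elim conjE)
    fix H S and K :: "'a set monoid" and f
    assume "subgroup H G" "T closure_of H = topspace T" and K: "topological_group K S"
      and f: "f \<in> epi (G\<lparr>carrier := H\<rparr>) K" "continuous_map (subtopology T H) S f"
    then have "second_countable S"
      by (intro dense_subgroup_image_second_countable[OF cpt sc])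
    then show "arhangelskii S"
      by (rule second_countable_imp_arhangelskii[OF topological_group.Hausdorff[OF K]])
  qed
qed

end
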